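(* Let $A_1,\ldots,A_n\subset\mathbb{R}^n$ be finite nonempty sets of sizes $t_1,\ldots,t_n$, and let $\mathfrak{f}=(\mathfrak{f}_1,\ldots,\mathfrak{f}_n)$ be the system of $n$ random fewnomials $$\mathfrak{f}_k=\sum_{\alpha\in A_k}\mathfrak{f}_{k,\alpha}X^\alpha\qquad(k=1,\ldots,n),$$ where the $\mathfrak{f}_{k,\alpha}$ ($1\le k\le n$, $\alpha\in A_k$) are independent centered Gaussian random variables with positive variances $\mathtt{v}_{k,\alpha}$. For each $k$ let $\lambda_k:A_k\to\mathbb{R}$ be the lifting function $$\lambda_k(\alpha)=\tfrac12\ln\mathtt{v}_{k,\alpha}.$$ Then $$\mathbb{E}_{\mathfrak{f}}\,\#\mathcal{Z}_r(\mathfrak{f},\mathbb{R}^n_+)\le\frac{1}{4^n}\,\mathsf{V}\!\left(\sum_{k=1}^n\mathcal{L}(A_k,\lambda_k)\right)\prod_{k=1}^n(t_k-1),$$ where $\mathsf{V}\left(\sum_{k=1}^n\mathcal{L}(A_k,\lambda_k)\right)$ is the number of vertices of the Minkowski sum $\sum_{k=1}^n\mathcal{L}(A_k,\lambda_k)$.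
   Context: $n\geq 1$ is an integer and $\mathbb{R}^n_+=\{x\in\mathbb{R}^n: x_i>0\text{ for all }i\}$. For $\alpha\in\mathbb{R}^n$ and $x\in\mathbb{R}^n_+$, $x^\alpha=\prod_{i=1}^n x_i^{\alpha_i}$. $\mathcal{Z}_r(\mathfrak{f},\mathbb{R}^n_+)$ is the set of regular zeros of $\mathfrak{f}$ in $\mathbb{R}^n_+$, i.e., the points $x\in\mathbb{R}^n_+$ with $\mathfrak{f}(x)=0$ and Jacobian determinant $\det \mathrm{D}_x\mathfrak{f}\neq0$. For a finite set $A\subset\mathbb{R}^n$ and a map $\lambda:A\to\mathbb{R}$, the upper envelope of $A$ with respect to $\lambda$ is the convex polyhedron $$\mathcal{L}(A,\lambda):=\operatorname{conv}\left\{\begin{pmatrix}\lambda(\alpha)-s\\\alpha\end{pmatrix}\;\middle|\;\alpha\in A,\ s\ge0\right\}\subset\mathbb{R}^{n+1}.$$ *)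

theory Defs
  imports "HOL-Probability.Probability"
begin

definition pos_orthant :: "(real ^ 'n) set" where
  "pos_orthant = {x. \<forall>i. 0 < x $ i}"

(* Real exponents: powr is the usual power only for positive bases, so this is
   meaningful on pos_orthant. *)
definition monomial :: "real ^ 'n \<Rightarrow> real ^ 'n \<Rightarrow> real" where
  "monomial \<alpha> x = (\<Prod>i\<in>UNIV. (x $ i) powr (\<alpha> $ i))"

definition fewnomial :: "(real ^ 'n) set \<Rightarrow> (real ^ 'n \<Rightarrow> real) \<Rightarrow> real ^ 'n \<Rightarrow> real" where
  "fewnomial A c x = (\<Sum>\<alpha>\<in>A. c \<alpha> * monomial \<alpha> x)"

definition fewnomial_system ::
  "('n \<Rightarrow> (real ^ 'n) set) \<Rightarrow> ('n \<Rightarrow> real ^ 'n \<Rightarrow> real) \<Rightarrow> real ^ 'n \<Rightarrow> real ^ 'n" where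
  "fewnomial_system A c x = (\<chi> k. fewnomial (A k) (c k) x)"

definition regular_zeros :: "(real ^ 'n \<Rightarrow> real ^ 'n) \<Rightarrow> (real ^ 'n) set \<Rightarrow> (real ^ 'n) set" where
  "regular_zeros f U = {x \<in> U. f x = 0 \<and> det (jacobian f (at x)) \<noteq> 0}"

(* R^(n+1) is rendered as real \<times> (real ^ 'n), the lifting value being the first coordinate. *)
definition upper_envelope ::
  "(real ^ 'n) set \<Rightarrow> (real ^ 'n \<Rightarrow> real) \<Rightarrow> (real \<times> (real ^ 'n)) set" where
  "upper_envelope A l = convex hull {(l \<alpha> - s, \<alpha>) | \<alpha> s. \<alpha> \<in> A \<and> 0 \<le> s}"

(* Only applied to polyhedra, whose vertices are their (finitely many) extreme points. *)
definition num_vertices :: "'a::real_vector set \<Rightarrow> nat" where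
  "num_vertices P = card {p. p extreme_point_of P}"

end

theory Submission
  imports Defs
begin

text \<open>
  Dividing each coefficient by its standard deviation and substituting \<open>x = exp y\<close> turns the system into
  \<open>h\<^sub>k(y) = (\<Sum>\<alpha>\<in>A\<^sub>k. c\<^sub>k\<^sub>\<alpha> exp (l\<^sub>k\<^sub>\<alpha> + \<alpha> \<bullet> y))\<close> with independent standard normal \<open>c\<^sub>k\<^sub>\<alpha>\<close>. For a
  selection \<open>s\<close> of one exponent per equation, let the cell of \<open>s\<close> be the set of all \<open>y\<close> at which
  \<open>l\<^sub>k\<^sub>\<alpha> + \<alpha> \<bullet> y\<close> is maximal at \<open>\<alpha> = s\<^sub>k\<close> for every \<open>k\<close>. The bound is the product of two facts: each cell
  contains at most \<open>4^-n \<Prod>(t\<^sub>k - 1)\<close> regular zeros in expectation, and as many cells as the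
  Minkowski sum has vertices suffice to cover the whole space.

  One cell (lemma \<open>expected_zeros_in_cell_le\<close>). Divide the \<open>k\<close>-th equation by its dominant term: \<open>y\<close> is a zero iff
  the dominant coefficients satisfy \<open>c\<^sub>k\<^sub>s = - (\<Sum>\<alpha>\<noteq>s\<^sub>k. c\<^sub>k\<^sub>\<alpha> w\<^sub>k\<^sub>\<alpha>(y)) =: g\<^sub>k(y)\<close>, where the weights
  \<open>w\<^sub>k\<^sub>\<alpha>(y) = exp (l\<^sub>k\<^sub>\<alpha> + \<alpha> \<bullet> y - l\<^sub>k\<^sub>s - s\<^sub>k \<bullet> y)\<close> are at most \<open>1\<close> on the cell. With the other coefficients fixed,
  the zeros are thus the preimages under \<open>g\<close> of a standard Gaussian vector, and the area formula gives
  their expected number as the integral of \<open>\<bar>det Dg\<bar> \<Prod>\<phi>(g\<^sub>k)\<close> over the cell, \<open>\<phi>\<close> being the standard normal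
  density. Expanding the determinant along its rows bounds \<open>\<bar>det Dg\<bar>\<close> by a sum over all choices of one exponent \<open>\<tau>\<^sub>k \<noteq> s\<^sub>k\<close> per equation, and
  by independence the expectation of the summand of \<open>\<tau>\<close> factors over \<open>k\<close>. Because the weights are at most
  \<open>1\<close>, the factor \<open>E (\<bar>c\<^sub>k\<^sub>\<tau>\<bar> \<phi>(g\<^sub>k))\<close> is at most \<open>1 / (\<pi> (1 + w\<^sub>k\<^sub>\<tau>^2))\<close>, whatever the other weights are.
  In the affine coordinates \<open>u\<^sub>k = - ln w\<^sub>k\<^sub>\<tau> \<ge> 0\<close> the integral of the \<open>\<tau>\<close>-summand becomes a product of integrals
  of \<open>exp (- u) / (\<pi> (1 + exp (- 2 u)))\<close> over the half-line, each of which equals \<open>arctan 1 / \<pi> = 1 / 4\<close>. There are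
  \<open>\<Prod>(t\<^sub>k - 1)\<close> choices of \<open>\<tau>\<close>.

  The cells (lemmas \<open>card_strict_selections_le\<close> and \<open>UN_dominance_cells\<close>). If \<open>s\<^sub>k\<close> is the only maximiser for every
  \<open>k\<close> at some \<open>y\<close>, then the linear functional \<open>(1, y)\<close> attains its maximum on the Minkowski sum only at
  \<open>\<Sum>(l\<^sub>k\<^sub>s, s\<^sub>k)\<close>, which is therefore a vertex, and this vertex determines \<open>s\<close>. The points without ties
  are dense and the cells are closed, so finitely many such cells cover the space.

  To add the expectations of the cells, the number of zeros in a cell has to be a measurable function of
  the coefficients; lemma \<open>measurable_number_of_regular_zeros\<close> provides this.
\<close>

section \<open>Change of variables over an arbitrary finite index type\<close>

text \<open>
  The theorem \<open>has_absolute_integral_change_of_variables\<close> concerns \<open>real^'m\<close> with a finite well-ordered index type.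
  To apply it to any finite index type, the latter is put in bijection with an initial segment of the naturals.
\<close>
typedef ('n::finite) ordinal_index = "{..<CARD('n)}"
  by (rule exI[of _ 0]) simp

setup_lifting type_definition_ordinal_index

instance ordinal_index :: (finite) finite
proof
  show "finite (UNIV :: 'a ordinal_index set)"
    by (rule finite_imageD[of Rep_ordinal_index])
      (auto intro: finite_subset[of _ "{..<CARD('a)}"] inj_onI simp: Rep_ordinal_index_inject Rep_ordinal_index[simplified])
qed

instantiation ordinal_index :: (finite) wellorder
begin
lift_definition less_eq_ordinal_index :: "'a ordinal_index \<Rightarrow> 'a ordinal_index \<Rightarrow> bool" is "(\<le>)" .
lift_definition less_ordinal_index :: "'a ordinal_index \<Rightarrow> 'a ordinal_index \<Rightarrow> bool" is "(<)" .
instance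
proof
  fix P :: "'a ordinal_index \<Rightarrow> bool" and a
  assume step: "\<And>x. (\<And>y. y < x \<Longrightarrow> P y) \<Longrightarrow> P x"
  show "P a"
    by (induction a rule: measure_induct_rule[of Rep_ordinal_index])
      (auto intro: step simp: less_ordinal_index.rep_eq)
qed (transfer; auto)+
end

lemma ex_ordinal_index_bij: "\<exists>e :: 'n::finite ordinal_index \<Rightarrow> 'n. bij e"
proof -
  have "CARD('n ordinal_index) = CARD('n)"
    by (simp add: type_definition.card[OF type_definition_ordinal_index])
  then show ?thesis
    by (simp add: finite_same_card_bij)
qed

lemma sign_conjugate:
  fixes e :: "'m::finite \<Rightarrow> 'n::finite"
  assumes "bij e" "p permutes (UNIV :: 'm set)"
  shows "sign (e \<circ> p \<circ> inv e) = sign p"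
proof -
  have e: "e (inv e y) = y" "inv e (e x) = x" for x y
    using \<open>bij e\<close> by (simp_all add: bij_is_surj surj_f_inv_f bij_is_inj)
  have "finite (UNIV :: 'm set)" by simp
  from this assms(2) show ?thesis
  proof (induction p rule: permutes_rev_induct)
    case id
    then show ?case using e by (simp add: comp_def flip: id_def)
  next
    case (swap a b p)
    have bp: "bij p" "permutation p"
      using swap by (auto simp: permutes_bij permutation_permutes)
    have conj: "e \<circ> (p \<circ> Transposition.transpose a b) \<circ> inv e
        = (e \<circ> p \<circ> inv e) \<circ> Transposition.transpose (e a) (e b)"
      using e by (auto simp: fun_eq_iff Transposition.transpose_def)
    have perm: "permutation (e \<circ> p \<circ> inv e)"
      using bp \<open>bij e\<close> by (auto simp: permutation bij_comp bij_imp_bij_inv)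
    have "e a = e b \<longleftrightarrow> a = b" using e by metis
    then show ?case
      unfolding conj sign_compose[OF perm permutation_swap_id] sign_compose[OF bp(2) permutation_swap_id]
      using swap by (simp add: sign_swap_id comp_def)
  qed
qed

text \<open>
  Conjugation by \<open>e\<close> matches the permutations in the two Leibniz sums and preserves their signs.
\<close>
lemma det_reindex:
  fixes e :: "'m::finite \<Rightarrow> 'n::finite" and A :: "real^'n^'n"
  assumes e: "bij e"
  shows "det (\<chi> i j. A $ e i $ e j) = det A"
proof -
  have ee: "e (inv e y) = y" "inv e (e x) = x" for x y
    using e by (simp_all add: bij_is_surj surj_f_inv_f bij_is_inj)
  have bij: "bij_betw (\<lambda>p. e \<circ> p \<circ> inv e) {p. p permutes (UNIV :: 'm set)} {p. p permutes (UNIV :: 'n set)}"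
  proof (rule bij_betw_byWitness[where f' = "\<lambda>p. inv e \<circ> p \<circ> e"])
    show "(\<lambda>p. e \<circ> p \<circ> inv e) ` {p. p permutes UNIV} \<subseteq> {p. p permutes UNIV}"
      using e by (auto intro!: bij_imp_permutes bij_comp bij_imp_bij_inv dest: permutes_bij)
    show "(\<lambda>p. inv e \<circ> p \<circ> e) ` {p. p permutes UNIV} \<subseteq> {p. p permutes UNIV}"
      using e by (auto intro!: bij_imp_permutes bij_comp bij_imp_bij_inv dest: permutes_bij)
  qed (auto simp: fun_eq_iff ee)
  have "det A = (\<Sum>p\<in>{p. p permutes (UNIV :: 'm set)}.
      of_int (sign (e \<circ> p \<circ> inv e)) * (\<Prod>i\<in>UNIV. A $ i $ (e \<circ> p \<circ> inv e) i))"
    unfolding det_def by (rule sum.reindex_bij_betw[OF bij, symmetric])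
  also have "\<dots> = det (\<chi> i j. A $ e i $ e j)"
    unfolding det_def
  proof (rule sum.cong, simp)
    fix p assume "p \<in> {p. p permutes (UNIV :: 'm set)}"
    moreover have "(\<Prod>i\<in>UNIV. A $ i $ (e \<circ> p \<circ> inv e) i) = (\<Prod>i\<in>UNIV. A $ e i $ (e \<circ> p \<circ> inv e) (e i))"
      using prod.reindex_bij_betw[OF e, of "\<lambda>i. A $ i $ (e \<circ> p \<circ> inv e) i"] by simp
    ultimately show "of_int (sign (e \<circ> p \<circ> inv e)) * (\<Prod>i\<in>UNIV. A $ i $ (e \<circ> p \<circ> inv e) i)
       = of_int (sign p) * (\<Prod>i\<in>UNIV. (\<chi> i j. A $ e i $ e j) $ i $ p i)"
      by (simp add: sign_conjugate[OF e] ee)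
  qed
  finally show ?thesis ..
qed

text \<open>
  The real integrand is viewed as a vector of length one, to which the change of variables for integrable vector-valued
  functions applies; nonnegativity turns the resulting integrals into nonnegative Lebesgue integrals.
\<close>
lemma nn_integral_change_of_variables_wellorder:
  fixes g :: "real^'m::{finite,wellorder} \<Rightarrow> real^'m::_" and f :: "real^'m::_ \<Rightarrow> real"
  assumes S: "S \<in> sets lebesgue"
    and dg: "\<And>x. x \<in> S \<Longrightarrow> (g has_derivative g' x) (at x within S)"
    and inj: "inj_on g S"
    and f: "integrable lborel f" "\<And>x. 0 \<le> f x"
  shows "(\<integral>\<^sup>+x. ennreal (f x) * indicator (g ` S) x \<partial>lborel)
       = (\<integral>\<^sup>+x. ennreal (\<bar>det (matrix (g' x))\<bar> * f (g x)) * indicator S x \<partial>lborel)"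
proof -
  let ?F = "\<lambda>x. vec (f x) :: real^1"
  have gS: "g ` S \<in> sets lebesgue"
    using dg by (intro differentiable_image_in_sets_lebesgue[OF S]) (auto simp: differentiable_on_def differentiable_def)
  have "integrable lebesgue f" using f(1) by (simp add: integrable_completion)
  then have fU: "set_integrable lebesgue UNIV f"
    by (simp add: set_integrable_def)
  have fa: "f absolutely_integrable_on (g ` S)"
    by (rule set_integrable_subset[OF fU gS]) simp
  then have fint: "(f has_integral integral (g ` S) f) (g ` S)"
    by (intro integrable_integral set_lebesgue_integral_eq_integral(1))
  have "?F absolutely_integrable_on (g ` S)"
    using fa by (subst absolutely_integrable_componentwise_iff) (simp add: Basis_vec_def inner_axis)
  moreover have "integral (g ` S) ?F = vec (integral (g ` S) f)"
    using fint by (intro integral_unique, subst has_integral_componentwise_iff)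
      (simp add: Basis_vec_def inner_axis)
  ultimately have "(\<lambda>x. \<bar>det (matrix (g' x))\<bar> *\<^sub>R ?F (g x)) absolutely_integrable_on S \<and>
      integral S (\<lambda>x. \<bar>det (matrix (g' x))\<bar> *\<^sub>R ?F (g x)) = vec (integral (g ` S) f)"
    using has_absolute_integral_change_of_variables[OF S dg inj, of ?F] by blast
  then have "((\<lambda>x. \<bar>det (matrix (g' x))\<bar> *\<^sub>R ?F (g x)) has_integral vec (integral (g ` S) f)) S"
    using has_integral_iff set_lebesgue_integral_eq_integral(1) by blast
  then have "((\<lambda>x. \<bar>det (matrix (g' x))\<bar> * f (g x)) has_integral integral (g ` S) f) S"
    by (subst (asm) has_integral_componentwise_iff) (simp add: Basis_vec_def inner_axis)
  then show ?thesis
    using fint f(2) by (simp add: nn_integral_has_integral_lebesgue')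
qed

lemma continuous_on_det [continuous_intros]:
  fixes J :: "'a::topological_space \<Rightarrow> real^'n::finite^'n"
  assumes "continuous_on S J"
  shows "continuous_on S (\<lambda>x. det (J x))"
  unfolding det_def by (intro continuous_intros assms)

definition reindex :: "('m \<Rightarrow> 'n) \<Rightarrow> real^'n \<Rightarrow> real^'m" where
  "reindex e x = (\<chi> i. x $ e i)"

lemma linear_reindex: "linear (reindex e)"
  by (intro linearI) (simp_all add: reindex_def vec_eq_iff)

lemma bounded_linear_reindex: "bounded_linear (reindex e :: real^'n::finite \<Rightarrow> real^'m::finite)"
  using linear_reindex linear_conv_bounded_linear by blast

lemma continuous_reindex [continuous_intros]: 
  "continuous_on A f \<Longrightarrow> continuous_on A (\<lambda>x. reindex e (f x :: real^'n::finite) :: real^'m::finite)"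
  using bounded_linear.continuous_on[OF bounded_linear_reindex] by blast

lemma measurable_reindex [measurable]: "(reindex e :: real^'n::finite \<Rightarrow> real^'m::finite) \<in> borel \<rightarrow>\<^sub>M borel"
  by (intro borel_measurable_continuous_onI continuous_reindex continuous_on_id)

lemma reindex_inverse:
  assumes "bij e"
  shows "reindex e (reindex (inv e) x) = x" "reindex (inv e) (reindex e y) = y"
  using assms by (simp_all add: reindex_def vec_eq_iff bij_is_surj surj_f_inv_f bij_is_inj)

lemma lborel_distr_reindex:
  fixes e :: "'m::finite \<Rightarrow> 'n::finite"
  assumes e: "bij e"
  shows "distr lborel borel (reindex e) = lborel"
proof (rule lborel_eqI[symmetric])
  fix l u :: "real^'m"
  assume lu: "\<And>b. b \<in> Basis \<Longrightarrow> l \<bullet> b \<le> u \<bullet> b"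
  then have le: "l $ i \<le> u $ i" for i
    by (metis axis_in_Basis_iff inner_axis inner_real_def mult.right_neutral Basis_real_def insert_iff)
  have all: "(\<forall>i. P (e i)) \<longleftrightarrow> (\<forall>i. P i)" for P
    using e by (metis bij_pointE)
  have prod: "(\<Prod>b\<in>Basis. z \<bullet> b) = (\<Prod>i\<in>UNIV. z $ i)" for z :: "real^'k::finite"
  proof -
    have "(Basis :: (real^'k) set) = (\<lambda>i. axis i 1) ` UNIV"
      by (auto simp: Basis_vec_def)
    moreover have "inj (\<lambda>i::'k. axis i (1::real))" by (simp add: inj_on_def axis_eq_axis)
    ultimately show ?thesis by (metis (no_types, lifting) prod.reindex_cong cart_eq_inner_axis)
  qed
  have vim: "reindex e -` box l u = box (reindex (inv e) l) (reindex (inv e) u)"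
    using all[of "\<lambda>i. l $ inv e i < _ $ i \<and> _ $ i < u $ inv e i"] e
    by (auto simp: mem_box_cart reindex_def bij_is_inj)
  have le': "\<forall>b\<in>Basis. reindex (inv e) l \<bullet> b \<le> reindex (inv e) u \<bullet> b"
    using le by (auto simp: Basis_vec_def inner_axis reindex_def)
  have "emeasure (distr lborel borel (reindex e)) (box l u) = emeasure lborel (box (reindex (inv e) l) (reindex (inv e) u))"
    by (subst emeasure_distr) (simp_all add: vim)
  also have "\<dots> = ennreal (\<Prod>i\<in>UNIV. (reindex (inv e) (u - l)) $ i)"
    using le' by (simp add: emeasure_lborel_box_eq prod flip: linear_diff[OF linear_reindex])
  also have "(\<Prod>i\<in>UNIV. (reindex (inv e) (u - l)) $ i) = (\<Prod>i\<in>UNIV. (u - l) $ i)"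
    using prod.reindex_bij_betw[OF bij_imp_bij_inv[OF e], of "\<lambda>i. (u - l) $ i"]
    by (simp add: reindex_def)
  finally show "emeasure (distr lborel borel (reindex e)) (box l u) = (\<Prod>b\<in>Basis. (u - l) \<bullet> b)"
    by (simp add: prod)
qed simp

text \<open>
  Renaming coordinates preserves Lebesgue measure; a Lebesgue measurable integrand is first replaced by
  a Borel measurable one that agrees with it off a Borel null set.
\<close>
lemma nn_integral_lborel_reindex:
  fixes e :: "'m::finite \<Rightarrow> 'n::finite" and f :: "real^'m \<Rightarrow> ennreal"
  assumes e: "bij e" and f: "f \<in> borel_measurable lebesgue"
  shows "(\<integral>\<^sup>+x. f x \<partial>lborel) = (\<integral>\<^sup>+x. f (reindex e x) \<partial>lborel)"
proof -
  obtain f' where f'[measurable]: "f' \<in> borel_measurable lborel" and ae: "AE x in lborel. f x = f' x"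
    using completion_ex_borel_measurable[OF f] by blast
  have "(\<integral>\<^sup>+x. f x \<partial>lborel) = (\<integral>\<^sup>+x. f' x \<partial>lborel)"
    by (rule nn_integral_cong_AE[OF ae])
  also have "\<dots> = (\<integral>\<^sup>+x. f' x \<partial>distr lborel borel (reindex e))"
    by (simp add: lborel_distr_reindex[OF e])
  also have "\<dots> = (\<integral>\<^sup>+x. f' (reindex e x) \<partial>lborel)"
    by (rule nn_integral_distr) simp_all
  also have "\<dots> = (\<integral>\<^sup>+x. f (reindex e x) \<partial>lborel)"
  proof (rule nn_integral_cong_AE)
    from ae obtain N where N: "{x. f x \<noteq> f' x} \<subseteq> N" "N \<in> null_sets lborel"
      by (auto elim!: AE_E simp: null_sets_def)
    then have "N \<in> null_sets (distr lborel borel (reindex e))"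
      by (simp add: lborel_distr_reindex[OF e])
    then have "reindex e -` N \<in> null_sets lborel"
      by (subst (asm) null_sets_distr_iff) simp_all
    then show "AE x in lborel. f' (reindex e x) = f (reindex e x)"
      using N(1) by (intro AE_I'[of "reindex e -` N"]) (auto dest!: subsetD[of "{x. f x \<noteq> f' x}"])
  qed
  finally show ?thesis .
qed

lemma borel_times_lebesgue_indicator:
  fixes F :: "'a::euclidean_space \<Rightarrow> ennreal"
  assumes "A \<in> sets lebesgue" "F \<in> borel_measurable borel"
  shows "(\<lambda>x. F x * indicator A x) \<in> borel_measurable lebesgue"
proof -
  have "F \<in> borel_measurable lebesgue" using assms(2) by (intro measurable_completion) simp
  then show ?thesis using assms(1) by measurable
qed

text \<open>
  Conjugating \<open>g\<close> with a renaming of the coordinates moves it to a well-ordered index type and changes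
  neither the integrals nor the Jacobian determinant.
\<close>
lemma nn_integral_change_of_variables:
  fixes g :: "real^'n::finite \<Rightarrow> real^'n" and J :: "real^'n \<Rightarrow> real^'n^'n" and f :: "real^'n \<Rightarrow> real"
  assumes S: "S \<in> sets lebesgue"
    and dg: "\<And>x. (g has_derivative (*v) (J x)) (at x)"
    and contJ: "continuous_on UNIV J"
    and inj: "inj_on g S"
    and f: "integrable lborel f" "\<And>x. 0 \<le> f x"
  shows "(\<integral>\<^sup>+x. ennreal (f x) * indicator (g ` S) x \<partial>lborel)
       = (\<integral>\<^sup>+x. ennreal (\<bar>det (J x)\<bar> * f (g x)) * indicator S x \<partial>lborel)"
proof -
  obtain e :: "'n ordinal_index \<Rightarrow> 'n" where e: "bij e" using ex_ordinal_index_bij by blast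
  let ?P = "reindex e" and ?Q = "reindex (inv e)"
  note PQ = reindex_inverse[OF e] and bq = bij_imp_bij_inv[OF e]
  define h where "h x = ?P (g (?Q x))" for x
  have fm[measurable]: "f \<in> borel_measurable borel" using f(1) by auto
  have contg: "continuous_on UNIV g"
    using dg by (auto intro!: has_derivative_continuous_on[of _ _ "\<lambda>x. (*v) (J x)"])
  then have gm[measurable]: "g \<in> borel_measurable borel" by (intro borel_measurable_continuous_onI)
  have detm[measurable]: "(\<lambda>x. det (J x)) \<in> borel_measurable borel"
    by (intro borel_measurable_continuous_onI continuous_on_det contJ)
  have PS: "?P ` S \<in> sets lebesgue"
    by (intro differentiable_image_in_sets_lebesgue[OF S])
      (auto simp: type_definition.card[OF type_definition_ordinal_index]
        intro!: bounded_linear_imp_differentiable_on bounded_linear_reindex)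
  have hS: "h ` (?P ` S) = ?P ` g ` S" by (simp add: image_image h_def PQ)
  have dh: "(h has_derivative ?P \<circ> (*v) (J (?Q x)) \<circ> ?Q) (at x)" for x
  proof -
    have "(?Q has_derivative ?Q) (at x)" "(?P has_derivative ?P) (at y)" for y
      by (simp_all add: bounded_linear_imp_has_derivative bounded_linear_reindex)
    then have "((?P \<circ> (g \<circ> ?Q)) has_derivative ?P \<circ> ((*v) (J (?Q x)) \<circ> ?Q)) (at x)"
      by (intro diff_chain_at dg)
    then show ?thesis by (simp add: h_def[abs_def] comp_def)
  qed
  have det: "det (matrix (?P \<circ> (*v) (J y) \<circ> ?Q)) = det (J y)" for y
  proof -
    have "matrix (?P \<circ> (*v) (J y) \<circ> ?Q) = (\<chi> i j. J y $ e i $ e j)"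
    proof -
      have "?Q (axis j 1) = axis (e j) 1" for j
        using e by (auto simp: reindex_def vec_eq_iff axis_def bij_is_inj bij_is_surj surj_f_inv_f)
      then show ?thesis
        by (simp add: matrix_def vec_eq_iff reindex_def matrix_vector_mul_component inner_axis column_def
            flip: matrix_vector_mult_basis)
    qed
    then show ?thesis by (simp add: det_reindex[OF e])
  qed
  have fQ: "integrable lborel (\<lambda>x. f (?Q x))"
  proof -
    have "integrable (distr lborel borel ?Q) f" using f(1) by (simp add: lborel_distr_reindex[OF bq])
    then show ?thesis by (subst (asm) integrable_distr_eq) simp_all
  qed
  have injh: "inj_on h (?P ` S)"
    using inj by (auto simp: inj_on_def h_def PQ) (metis PQ)
  have gS: "g ` S \<in> sets lebesgue"
    using dg by (intro differentiable_image_in_sets_lebesgue[OF S])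
      (auto simp: differentiable_on_def differentiable_def intro: has_derivative_at_withinI)
  note m = borel_times_lebesgue_indicator
  have Pimg: "indicator (?P ` A) x = (indicator A (?Q x) :: ennreal)" for A x
    by (auto simp: indicator_def image_iff PQ) (metis PQ)+
  have "(\<integral>\<^sup>+x. ennreal (f x) * indicator (g ` S) x \<partial>lborel)
      = (\<integral>\<^sup>+x. ennreal (f (?Q x)) * indicator (g ` S) (?Q x) \<partial>lborel)"
    by (rule nn_integral_lborel_reindex[OF bq m[OF gS]]) simp
  also have "\<dots> = (\<integral>\<^sup>+x. ennreal (f (?Q x)) * indicator (h ` ?P ` S) x \<partial>lborel)"
    by (simp add: hS Pimg)
  also have "\<dots> = (\<integral>\<^sup>+x. ennreal (\<bar>det (J (?Q x))\<bar> * f (?Q (h x))) * indicator (?P ` S) x \<partial>lborel)"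
    using nn_integral_change_of_variables_wellorder[OF PS has_derivative_at_withinI[OF dh] injh fQ f(2)]
    by (simp only: det)
  also have "\<dots> = (\<integral>\<^sup>+x. ennreal (\<bar>det (J (?Q x))\<bar> * f (g (?Q x))) * indicator S (?Q x) \<partial>lborel)"
    by (simp add: h_def PQ Pimg)
  also have "\<dots> = (\<integral>\<^sup>+x. ennreal (\<bar>det (J x)\<bar> * f (g x)) * indicator S x \<partial>lborel)"
    by (rule nn_integral_lborel_reindex[OF bq m[OF S], symmetric]) simp
  finally show ?thesis .
qed

section \<open>The area formula\<close>

text \<open>
  The inverse function theorem; continuity of the matrix entries gives continuity of the derivative
  in operator norm.
\<close>
lemma locally_injective_on_regular_points:
  fixes g :: "real^'n::finite \<Rightarrow> real^'n" and J :: "real^'n \<Rightarrow> real^'n^'n"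
  assumes dg: "\<And>x. (g has_derivative (*v) (J x)) (at x)"
    and contJ: "continuous_on UNIV J"
    and reg: "det (J a) \<noteq> 0"
  obtains r where "r > 0" "inj_on g (ball a r)"
proof -
  obtain K where K: "K ** J a = mat 1"
    using reg invertible_det_nz[of "J a"] by (auto simp: invertible_def)
  have small: "\<exists>d>0. \<forall>x. dist a x < d \<longrightarrow> onorm (\<lambda>v. J x *v v - J a *v v) < e" if "e > 0" for e :: real
  proof -
    let ?N = "real CARD('n) * real CARD('n)"
    have N: "?N > 0" by simp
    let ?q = "\<lambda>x. \<Sum>i\<in>UNIV. \<Sum>j\<in>UNIV. \<bar>J x $ i $ j - J a $ i $ j\<bar>"
    have cq: "continuous_on UNIV ?q" 
      by (intro continuous_intros contJ)
    have bound: "onorm (\<lambda>v. J x *v v - J a *v v) \<le> ?N * ?q x" for x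
    proof -
      have "\<bar>(J x - J a) $ i $ j\<bar> \<le> ?q x" for i j
      proof -
        have "\<bar>J x $ i $ j - J a $ i $ j\<bar> \<le> (\<Sum>j\<in>UNIV. \<bar>J x $ i $ j - J a $ i $ j\<bar>)"
          by (rule member_le_sum) auto
        also have "\<dots> \<le> ?q x"
          by (rule member_le_sum[where f = "\<lambda>i. \<Sum>j\<in>UNIV. \<bar>J x $ i $ j - J a $ i $ j\<bar>"]) (auto intro: sum_nonneg)
        finally show ?thesis by simp
      qed
      then have "onorm ((*v) (J x - J a)) \<le> ?N * ?q x"
        by (rule onorm_le_matrix_component)
      moreover have "(*v) (J x - J a) = (\<lambda>v. J x *v v - J a *v v)"
        by (simp add: fun_eq_iff matrix_vector_mult_diff_rdistrib)
      ultimately show ?thesis by simp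
    qed
    have "\<exists>d>0. \<forall>x. dist x a < d \<longrightarrow> dist (?q x) (?q a) < e / ?N"
      using cq[unfolded continuous_on_iff, rule_format, of a "e / ?N"] that N by auto
    then obtain d where d: "d > 0" "\<And>x. dist x a < d \<Longrightarrow> ?q x < e / ?N"
      by (force simp: dist_real_def)
    have "onorm (\<lambda>v. J x *v v - J a *v v) < e" if "dist a x < d" for x
    proof -
      have "?q x < e / ?N" using d(2)[of x] that by (simp add: dist_commute)
      then have "?N * ?q x < e" using N by (simp add: field_simps)
      with bound[of x] show ?thesis by linarith
    qed
    with d(1) show ?thesis by blast
  qed
  have "(*v) K \<circ> (*v) (J a) = id"
    using K by (auto simp: fun_eq_iff matrix_vector_mul_assoc)
  then show ?thesis
    by (rule has_derivative_locally_injective[OF UNIV_I open_UNIV matrix_vector_mul_bounded_linear _ dg small])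
      (auto intro: that)
qed

lemma emeasure_count_space_at_most_one:
  assumes "inj_on g D"
  shows "emeasure (count_space UNIV) {y \<in> D. g y = z} = indicator (g ` D) z"
proof (cases "z \<in> g ` D")
  case True
  then obtain y where "y \<in> D" "g y = z" by blast
  then have "{y \<in> D. g y = z} = {y}" using assms by (auto simp: inj_on_def)
  then show ?thesis using True by simp
next
  case False
  then have "{y \<in> D. g y = z} = {}" by auto
  then show ?thesis using False by (simp only: emeasure_empty) simp
qed

text \<open>
  By Lindelof, countably many balls on which \<open>g\<close> is injective cover the regular points. Made disjoint, they
  split the regular points of \<open>S\<close> into pieces \<open>D n\<close> such that a value has at most one preimage in each, so the number of regular
  preimages of \<open>z\<close> is the number of images \<open>g ` D n\<close> that contain \<open>z\<close>; on each piece the injective change of variables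
  applies. Critical points contribute nothing to either side.
\<close>
lemma area_formula:
  fixes g :: "real^'n::finite \<Rightarrow> real^'n" and J :: "real^'n \<Rightarrow> real^'n^'n" and f :: "real^'n \<Rightarrow> real"
  assumes S: "S \<in> sets lebesgue"
    and dg: "\<And>x. (g has_derivative (*v) (J x)) (at x)"
    and contJ: "continuous_on UNIV J"
    and f: "integrable lborel f" "\<And>x. 0 \<le> f x"
  shows "(\<integral>\<^sup>+z. ennreal (f z) * emeasure (count_space UNIV) {y \<in> S. g y = z \<and> det (J y) \<noteq> 0} \<partial>lborel)
       = (\<integral>\<^sup>+y. ennreal (\<bar>det (J y)\<bar> * f (g y)) * indicator S y \<partial>lborel)"
proof -
  let ?U = "{y. det (J y) \<noteq> 0}"
  have openU: "open ?U"
    by (intro open_Collect_neq continuous_on_det contJ continuous_on_const)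
  have fm[measurable]: "f \<in> borel_measurable borel" using f(1) by auto
  have contg: "continuous_on UNIV g"
    using dg by (auto intro!: has_derivative_continuous_on[of _ _ "\<lambda>x. (*v) (J x)"])
  then have gm[measurable]: "g \<in> borel_measurable borel" by (intro borel_measurable_continuous_onI)
  have detm[measurable]: "(\<lambda>x. det (J x)) \<in> borel_measurable borel"
    by (intro borel_measurable_continuous_onI continuous_on_det contJ)
  have "\<forall>a\<in>?U. \<exists>r>0. inj_on g (ball a r)"
    using locally_injective_on_regular_points[OF dg contJ] by (metis mem_Collect_eq)
  then obtain r where r: "\<And>a. a \<in> ?U \<Longrightarrow> r a > 0 \<and> inj_on g (ball a (r a))" by metis
  obtain F' where F': "F' \<subseteq> (\<lambda>a. ball a (r a)) ` ?U" "countable F'" "\<Union>F' = (\<Union>a\<in>?U. ball a (r a))"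
    using Lindelof[of "(\<lambda>a. ball a (r a)) ` ?U"] by auto
  define B where "B = from_nat_into (insert {} F')"
  have rB: "range B = insert {} F'"
    unfolding B_def using F'(2) by (intro range_from_nat_into) auto
  have B: "open (B n)" "inj_on g (B n)" for n
  proof -
    have "B n \<in> insert {} F'" using rB by blast
    then have "B n = {} \<or> (\<exists>a\<in>?U. B n = ball a (r a))" using F'(1) by blast
    then show "open (B n)" "inj_on g (B n)" using r by auto
  qed
  have UB: "?U \<subseteq> (\<Union>n. B n)"
    using rB F'(3) r by force
  define D where "D n = disjointed B n \<inter> (S \<inter> ?U)" for n
  have Dl: "D n \<in> sets lebesgue" for n
  proof -
    have "range (disjointed B) \<subseteq> sets borel" by (intro sets.range_disjointed_sets) (use B in auto)
    then have "disjointed B n \<in> sets borel" by blast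
    then show ?thesis using S openU unfolding D_def
      by (intro sets.Int) (auto intro: sets_completionI_sets)
  qed
  have dD: "disjoint_family D"
    using disjoint_family_disjointed[of B] by (auto simp: disjoint_family_on_def D_def)
  have UD: "(\<Union>n. D n) = S \<inter> ?U"
    using UB UN_disjointed_eq[of B] by (auto simp: D_def)
  have injD: "inj_on g (D n)" for n
    by (rule inj_on_subset[OF B(2)[of n]]) (use disjointed_subset[of B n] in \<open>auto simp: D_def\<close>)
  have count: "emeasure (count_space UNIV) {y \<in> S. g y = z \<and> det (J y) \<noteq> 0} = (\<Sum>n. indicator (g ` D n) z)" for z
  proof -
    have "(\<Sum>n. emeasure (count_space UNIV) {y \<in> D n. g y = z}) = emeasure (count_space UNIV) (\<Union>n. {y \<in> D n. g y = z})"
      using dD by (intro suminf_emeasure) (auto simp: disjoint_family_on_def)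
    moreover have "(\<Union>n. {y \<in> D n. g y = z}) = {y \<in> S. g y = z \<and> det (J y) \<noteq> 0}"
      using UD by blast
    ultimately show ?thesis by (simp add: emeasure_count_space_at_most_one[OF injD])
  qed
  have gD: "g ` D n \<in> sets lebesgue" for n
    using dg by (intro differentiable_image_in_sets_lebesgue[OF Dl])
      (auto simp: differentiable_on_def differentiable_def intro: has_derivative_at_withinI)
  note m = borel_times_lebesgue_indicator
  have "(\<integral>\<^sup>+z. ennreal (f z) * emeasure (count_space UNIV) {y \<in> S. g y = z \<and> det (J y) \<noteq> 0} \<partial>lborel)
      = (\<integral>\<^sup>+z. (\<Sum>n. ennreal (f z) * indicator (g ` D n) z) \<partial>lebesgue)"
    by (simp add: count ennreal_suminf_cmult nn_integral_completion)
  also have "\<dots> = (\<Sum>n. \<integral>\<^sup>+z. ennreal (f z) * indicator (g ` D n) z \<partial>lebesgue)"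
    by (intro nn_integral_suminf m gD) simp
  also have "\<dots> = (\<Sum>n. \<integral>\<^sup>+y. ennreal (\<bar>det (J y)\<bar> * f (g y)) * indicator (D n) y \<partial>lebesgue)"
    unfolding nn_integral_completion
    by (simp add: nn_integral_change_of_variables[OF Dl dg contJ injD f])
  also have "\<dots> = (\<integral>\<^sup>+y. (\<Sum>n. ennreal (\<bar>det (J y)\<bar> * f (g y)) * indicator (D n) y) \<partial>lebesgue)"
    by (intro nn_integral_suminf[symmetric] m Dl) simp
  also have "\<dots> = (\<integral>\<^sup>+y. ennreal (\<bar>det (J y)\<bar> * f (g y)) * indicator S y \<partial>lebesgue)"
  proof (rule nn_integral_cong)
    fix y
    show "(\<Sum>n. ennreal (\<bar>det (J y)\<bar> * f (g y)) * indicator (D n) y) = ennreal (\<bar>det (J y)\<bar> * f (g y)) * indicator S y"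
      using suminf_indicator[OF dD, of y] by (auto simp: ennreal_suminf_cmult UD indicator_def)
  qed
  finally show ?thesis by (simp add: nn_integral_completion)
qed

section \<open>Measurability of the number of regular zeros\<close>

text \<open>
  By compactness, \<open>q \<omega>\<close> has a zero in \<open>K\<close> iff its infimum over \<open>K\<close> is \<open>0\<close>, and by continuity a countable dense
  subset of \<open>K\<close> suffices to compute this infimum.
\<close>
lemma measurable_zero_exists_compact:
  fixes q :: "'w \<Rightarrow> 'a::euclidean_space \<Rightarrow> real"
  assumes K: "compact K"
    and cont: "\<And>\<omega>. \<omega> \<in> space M \<Longrightarrow> continuous_on UNIV (q \<omega>)"
    and meas[measurable]: "\<And>y. (\<lambda>\<omega>. q \<omega> y) \<in> borel_measurable M"
    and nonneg: "\<And>\<omega> y. 0 \<le> q \<omega> y"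
  shows "{\<omega> \<in> space M. \<exists>y\<in>K. q \<omega> y = 0} \<in> sets M"
proof -
  obtain T where T: "countable T" "T \<subseteq> K" "K \<subseteq> closure T" by (rule separable)
  have "(\<exists>y\<in>K. q \<omega> y = 0) \<longleftrightarrow> (\<forall>j. \<exists>t\<in>T. q \<omega> t < 1 / real (Suc j))" if \<omega>: "\<omega> \<in> space M" for \<omega>
  proof safe
    fix y j assume y: "y \<in> K" "q \<omega> y = 0"
    have "open {x. q \<omega> x < 1 / real (Suc j)}"
      by (intro open_Collect_less cont[OF \<omega>] continuous_on_const)
    moreover have "y \<in> {x. q \<omega> x < 1 / real (Suc j)}" using y by simp
    ultimately show "\<exists>t\<in>T. q \<omega> t < 1 / real (Suc j)"
      using y(1) T(3) open_Int_closure_eq_empty[of "{x. q \<omega> x < 1 / real (Suc j)}" T] by blast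
  next
    assume small: "\<forall>j. \<exists>t\<in>T. q \<omega> t < 1 / real (Suc j)"
    then have "K \<noteq> {}" using T(2) by auto
    then obtain y0 where y0: "y0 \<in> K" "\<And>y. y \<in> K \<Longrightarrow> q \<omega> y0 \<le> q \<omega> y"
      using continuous_attains_inf[OF K] continuous_on_subset[OF cont[OF \<omega>]] by (metis subset_UNIV)
    have lt: "q \<omega> y0 < 1 / real (Suc j)" for j
      using small y0(2) T(2) by (meson le_less_trans subsetD)
    have "q \<omega> y0 \<le> 0"
    proof (rule ccontr)
      assume "\<not> q \<omega> y0 \<le> 0"
      then obtain j where "1 / real (Suc j) < q \<omega> y0" using nat_approx_posE[of "q \<omega> y0"] by auto
      with lt[of j] show False by simp
    qed
    then show "\<exists>y\<in>K. q \<omega> y = 0" using y0(1) nonneg[of \<omega> y0] by (auto intro: antisym)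
  qed
  then have "{\<omega> \<in> space M. \<exists>y\<in>K. q \<omega> y = 0} = {\<omega> \<in> space M. \<forall>j. \<exists>t\<in>T. q \<omega> t < 1 / real (Suc j)}"
    by blast
  also have "\<dots> \<in> sets M" using T(1) by measurable
  finally show ?thesis .
qed

text \<open>
  Adding \<open>max 0 (1 / (j + 1) - \<bar>d\<bar>)\<close> to \<open>\<bar>h\<bar>\<close> yields a continuous function whose zeros are exactly the zeros of \<open>h\<close> with
  \<open>\<bar>d\<bar> \<ge> 1 / (j + 1)\<close>. This replaces the open condition \<open>d \<noteq> 0\<close> by countably many closed ones.
\<close>
lemma measurable_regular_zero_exists:
  fixes h :: "'w \<Rightarrow> 'a::euclidean_space \<Rightarrow> 'b::euclidean_space" and d :: "'w \<Rightarrow> 'a \<Rightarrow> real"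
  assumes S: "fsigma S"
    and h: "\<And>\<omega>. \<omega> \<in> space M \<Longrightarrow> continuous_on UNIV (h \<omega>)" "\<And>y. (\<lambda>\<omega>. h \<omega> y) \<in> borel_measurable M"
    and d: "\<And>\<omega>. \<omega> \<in> space M \<Longrightarrow> continuous_on UNIV (d \<omega>)" "\<And>y. (\<lambda>\<omega>. d \<omega> y) \<in> borel_measurable M"
  shows "{\<omega> \<in> space M. \<exists>y\<in>S. h \<omega> y = 0 \<and> d \<omega> y \<noteq> 0} \<in> sets M"
proof -
  note [measurable] = h(2) d(2)
  from S obtain K :: "nat \<Rightarrow> 'a set" where "range K \<subseteq> Collect compact" "S = \<Union>(range K)"
    unfolding fsigma_Union_compact by (elim exE conjE)
  then have K: "\<And>n. compact (K n)" "S = (\<Union>n. K n)" by auto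
  define q where "q j \<omega> y = norm (h \<omega> y) + max 0 (1 / real (Suc j) - \<bar>d \<omega> y\<bar>)" for j \<omega> y
  have q0: "q j \<omega> y = 0 \<longleftrightarrow> h \<omega> y = 0 \<and> 1 / real (Suc j) \<le> \<bar>d \<omega> y\<bar>" for j \<omega> y
  proof -
    have "max 0 (1 / real (Suc j) - \<bar>d \<omega> y\<bar>) = 0 \<longleftrightarrow> 1 / real (Suc j) \<le> \<bar>d \<omega> y\<bar>" by linarith
    then show ?thesis unfolding q_def by (subst add_nonneg_eq_0_iff) (simp_all only: norm_ge_zero max.cobounded1 norm_eq_zero)
  qed
  have dn: "d \<omega> y \<noteq> 0 \<longleftrightarrow> (\<exists>j. 1 / real (Suc j) \<le> \<bar>d \<omega> y\<bar>)" for \<omega> y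
  proof
    assume "d \<omega> y \<noteq> 0"
    then obtain j where "1 / real (Suc j) < \<bar>d \<omega> y\<bar>" using nat_approx_posE[of "\<bar>d \<omega> y\<bar>"] by auto
    then show "\<exists>j. 1 / real (Suc j) \<le> \<bar>d \<omega> y\<bar>" by (intro exI[of _ j]) simp
  next
    assume "\<exists>j. 1 / real (Suc j) \<le> \<bar>d \<omega> y\<bar>"
    then obtain j where "1 / real (Suc j) \<le> \<bar>d \<omega> y\<bar>" ..
    moreover have "0 < 1 / real (Suc j)" by simp
    ultimately show "d \<omega> y \<noteq> 0" by linarith
  qed
  have "{\<omega> \<in> space M. \<exists>y\<in>S. h \<omega> y = 0 \<and> d \<omega> y \<noteq> 0}
      = (\<Union>n j. {\<omega> \<in> space M. \<exists>y\<in>K n. q j \<omega> y = 0})"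
    unfolding q0 dn K(2) by blast
  also have "\<dots> \<in> sets M"
  proof -
    have "{\<omega> \<in> space M. \<exists>y\<in>K n. q j \<omega> y = 0} \<in> sets M" for n j
    proof (rule measurable_zero_exists_compact[OF K(1)])
      show "continuous_on UNIV (q j \<omega>)" if "\<omega> \<in> space M" for \<omega>
        unfolding q_def by (intro continuous_intros h d that)
      show "(\<lambda>\<omega>. q j \<omega> y) \<in> borel_measurable M" for y unfolding q_def by measurable
      show "0 \<le> q j \<omega> y" for \<omega> y unfolding q_def by simp
    qed
    then show ?thesis by (intro sets.countable_nat_UN image_subsetI)
  qed
  finally show ?thesis .
qed

lemma finite_separated_by_basis:
  fixes Z :: "'a::metric_space set"
  assumes "topological_basis \<B>" "finite Z"
  obtains b where "\<And>z. z \<in> Z \<Longrightarrow> b z \<in> \<B> \<and> z \<in> b z" "disjoint_family_on b Z"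
proof -
  have "\<forall>z. \<exists>d>0. \<forall>x\<in>Z. x \<noteq> z \<longrightarrow> d \<le> dist z x"
    using finite_set_avoid[OF assms(2)] by blast
  then obtain d where d: "\<And>z. d z > 0" "\<And>z x. x \<in> Z \<Longrightarrow> x \<noteq> z \<Longrightarrow> d z \<le> dist z x" by metis
  have "\<exists>B\<in>\<B>. z \<in> B \<and> B \<subseteq> ball z (d z / 2)" for z
    using topological_basisE[OF assms(1) open_ball, of z z "d z / 2"] d(1)[of z] by (metis centre_in_ball half_gt_zero)
  then obtain b where b: "\<And>z. b z \<in> \<B> \<and> z \<in> b z \<and> b z \<subseteq> ball z (d z / 2)" by metis
  have "b z \<inter> b x = {}" if "z \<in> Z" "x \<in> Z" "z \<noteq> x" for z x
  proof -
    have "d z \<le> dist z x" "d x \<le> dist z x" using d(2)[of x z] d(2)[of z x] that by (auto simp: dist_commute)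
    then have "d z / 2 + d x / 2 \<le> dist z x" by simp
    then have "ball z (d z / 2) \<inter> ball x (d x / 2) = {}" by (rule disjoint_ballI)
    then show ?thesis using b by blast
  qed
  then show ?thesis using b by (intro that) (auto simp: disjoint_family_on_def)
qed

lemma emeasure_count_space_eq_SUP_finite:
  "emeasure (count_space UNIV) Z = (SUP Y\<in>{Y. finite Y \<and> Y \<subseteq> Z}. of_nat (card Y))"
proof (cases "finite Z")
  case True
  then show ?thesis
    by (intro antisym SUP_upper2[of Z] SUP_least) (auto simp: card_mono emeasure_count_space_finite)
next
  case False
  have "of_nat n \<le> (SUP Y\<in>{Y. finite Y \<and> Y \<subseteq> Z}. of_nat (card Y) :: ennreal)" for n
    using infinite_arbitrarily_large[OF False, of n] by (auto intro!: SUP_upper2)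
  then have "(SUP n. of_nat n) \<le> (SUP Y\<in>{Y. finite Y \<and> Y \<subseteq> Z}. of_nat (card Y) :: ennreal)"
    by (rule SUP_least)
  then have "(SUP Y\<in>{Y. finite Y \<and> Y \<subseteq> Z}. of_nat (card Y) :: ennreal) = \<top>"
    unfolding ennreal_SUP_of_nat_eq_top by (rule top_unique[THEN iffD1])
  then show ?thesis using emeasure_count_space_infinite[OF subset_UNIV False] by (simp only: infinity_ennreal_def)
qed

text \<open>
  A set has at least \<open>m\<close> elements iff \<open>m\<close> pairwise disjoint basic open sets meet it. For a countable basis
  the supremum ranges over a countable family, so that the measurability of a random cardinality reduces to that of
  the events that the random set meets a fixed open set.
\<close>
lemma emeasure_count_space_eq_SUP_basis:
  fixes Z :: "'a::metric_space set"
  assumes \<B>: "topological_basis \<B>"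
  shows "emeasure (count_space UNIV) Z
    = (SUP P\<in>{P. finite P \<and> P \<subseteq> \<B> \<and> disjoint P}. \<Sum>b\<in>P. if Z \<inter> b \<noteq> {} then 1 else 0)" (is "_ = ?R")
proof (rule antisym)
  show "emeasure (count_space UNIV) Z \<le> ?R"
    unfolding emeasure_count_space_eq_SUP_finite[of Z]
  proof (safe intro!: SUP_least)
    fix Y assume Y: "finite Y" "Y \<subseteq> Z"
    obtain b where b: "\<And>z. z \<in> Y \<Longrightarrow> b z \<in> \<B> \<and> z \<in> b z" "disjoint_family_on b Y"
      using finite_separated_by_basis[OF \<B> Y(1)] by blast
    have inj: "inj_on b Y"
      using b by (auto simp: inj_on_def disjoint_family_on_def) blast
    have "of_nat (card Y) = (\<Sum>y\<in>Y. if Z \<inter> b y \<noteq> {} then 1 else (0::ennreal))"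
      using b(1) Y(2) by (subst sum.cong[OF refl, of _ _ "\<lambda>_. 1"]) auto
    also have "\<dots> = (\<Sum>B\<in>b ` Y. if Z \<inter> B \<noteq> {} then 1 else 0)"
      by (simp add: sum.reindex[OF inj])
    also have "\<dots> \<le> ?R"
      using Y(1) b disjoint_family_on_disjoint_image[OF b(2)] by (intro SUP_upper) auto
    finally show "of_nat (card Y) \<le> ?R" .
  qed
  show "?R \<le> emeasure (count_space UNIV) Z"
  proof (safe intro!: SUP_least)
    fix P assume P: "finite P" "P \<subseteq> \<B>" "disjoint P"
    have "(\<Sum>b\<in>P. if Z \<inter> b \<noteq> {} then 1 else 0) \<le> (\<Sum>b\<in>P. emeasure (count_space UNIV) (Z \<inter> b))"
    proof (rule sum_mono)
      fix b
      show "(if Z \<inter> b \<noteq> {} then 1 else 0) \<le> emeasure (count_space UNIV) (Z \<inter> b)"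
      proof (cases "Z \<inter> b = {}")
        case False
        then obtain z where "{z} \<subseteq> Z \<inter> b" by blast
        from emeasure_mono[OF this, of "count_space UNIV"] show ?thesis using False by simp
      qed simp
    qed
    also have "\<dots> = emeasure (count_space UNIV) (\<Union>b\<in>P. Z \<inter> b)"
      using P by (intro sum_emeasure) (auto simp: disjoint_family_on_def disjoint_def)
    also have "\<dots> \<le> emeasure (count_space UNIV) Z" by (intro emeasure_mono) auto
    finally show "(\<Sum>b\<in>P. if Z \<inter> b \<noteq> {} then 1 else 0) \<le> emeasure (count_space UNIV) Z" .
  qed
qed

text \<open>
  The cardinality of a random set of regular zeros is a countable supremum of finite sums of indicators of the events
  that there is a zero in \<open>C \<inter> b\<close>, with \<open>b\<close> a basic open set; such an intersection is a countable union of compact sets.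
\<close>
lemma measurable_number_of_regular_zeros:
  fixes h :: "'w \<Rightarrow> 'a::euclidean_space \<Rightarrow> 'b::euclidean_space" and d :: "'w \<Rightarrow> 'a \<Rightarrow> real"
  assumes C: "closed C"
    and h: "\<And>\<omega>. \<omega> \<in> space M \<Longrightarrow> continuous_on UNIV (h \<omega>)" "\<And>y. (\<lambda>\<omega>. h \<omega> y) \<in> borel_measurable M"
    and d: "\<And>\<omega>. \<omega> \<in> space M \<Longrightarrow> continuous_on UNIV (d \<omega>)" "\<And>y. (\<lambda>\<omega>. d \<omega> y) \<in> borel_measurable M"
  shows "(\<lambda>\<omega>. emeasure (count_space UNIV) {y \<in> C. h \<omega> y = 0 \<and> d \<omega> y \<noteq> 0}) \<in> borel_measurable M"
proof -
  obtain \<B> :: "'a set set" where \<B>: "countable \<B>" "topological_basis \<B>" 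
    using ex_countable_basis by blast
  have cnt: "countable {P. finite P \<and> P \<subseteq> \<B> \<and> disjoint P}"
    by (rule countable_subset[OF _ countable_Collect_finite_subset[OF \<B>(1)]]) auto
  have "{\<omega> \<in> space M. {y \<in> C. h \<omega> y = 0 \<and> d \<omega> y \<noteq> 0} \<inter> b \<noteq> {}} \<in> sets M" if b: "b \<in> \<B>" for b
  proof -
    obtain K :: "nat \<Rightarrow> 'a set" where K: "\<And>n. compact (K n)" "\<Union>(range K) = b"
      using open_Union_compact_subsets[OF topological_basis_open, OF \<B>(2) b] by metis
    have "fsigma (C \<inter> b)"
      unfolding fsigma_Union_compact
      using K C by (intro exI[of _ "\<lambda>n. C \<inter> K n"]) (auto intro: closed_Int_compact)
    from measurable_regular_zero_exists[OF this h d]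
    show ?thesis by (rule back_subst[of "\<lambda>A. A \<in> sets M"]) auto
  qed
  then have *: "Measurable.pred M (\<lambda>\<omega>. {y \<in> C. h \<omega> y = 0 \<and> d \<omega> y \<noteq> 0} \<inter> b \<noteq> {})" if "b \<in> \<B>" for b
    using that by (simp add: pred_def)
  show ?thesis
    unfolding emeasure_count_space_eq_SUP_basis[OF \<B>(2)]
    using * by (intro borel_measurable_SUP cnt borel_measurable_sum measurable_If) auto
qed

section \<open>Gaussian integrals for one equation\<close>

abbreviation std_normal :: "real measure" where
  "std_normal \<equiv> density lborel (\<lambda>x. ennreal (std_normal_density x))"

lemma prob_space_std_normal: "prob_space std_normal"
  by (rule prob_space_normal_density) simp

interpretation std_normal_product: product_sigma_finite "\<lambda>_ :: 'i. std_normal"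
  by (intro product_sigma_finite.intro prob_space_imp_sigma_finite prob_space_std_normal)

lemma nn_integral_std_normal:
  assumes [measurable]: "f \<in> borel_measurable borel"
  shows "(\<integral>\<^sup>+x. f x \<partial>std_normal) = (\<integral>\<^sup>+x. ennreal (std_normal_density x) * f x \<partial>lborel)"
  by (rule nn_integral_density) simp_all

text \<open>
  Rescaling step for the substitution \<open>y = - w t\<close> in the convolution below.
\<close>
lemma normal_density_std_scale:
  assumes "w \<noteq> 0"
  shows "normal_density 0 \<bar>w\<bar> (- (w * t)) = std_normal_density t / \<bar>w\<bar>"
  using assms by (simp add: normal_density_def real_sqrt_mult power_mult_distrib field_simps)

text \<open>
  The sum of independent centered normal variables with variances \<open>v\<close> and \<open>w^2\<close> is centered normal with
  variance \<open>v + w^2\<close>.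
\<close>
lemma nn_integral_normal_density_shift:
  assumes "v > 0"
  shows "(\<integral>\<^sup>+y. ennreal (normal_density 0 (sqrt v) (a + y * w)) \<partial>std_normal)
      = ennreal (normal_density 0 (sqrt (v + w\<^sup>2)) a)"
proof (cases "w = 0")
  case True
  interpret prob_space std_normal by (rule prob_space_std_normal)
  have "(\<integral>\<^sup>+y. ennreal (normal_density 0 (sqrt v) a) \<partial>std_normal) = ennreal (normal_density 0 (sqrt v) a)"
    using emeasure_space_1 by simp
  then show ?thesis using True by simp
next
  case False
  have "ennreal (normal_density 0 (sqrt (v + w\<^sup>2)) a)
      = (\<integral>\<^sup>+y. ennreal (normal_density 0 (sqrt v) (a - y) * normal_density 0 \<bar>w\<bar> y) \<partial>lborel)"
    using fun_cong[OF conv_normal_density_zero_mean[of "sqrt v" "\<bar>w\<bar>"], of a] assms False by simp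
  also have "\<dots> = \<bar>w\<bar> * (\<integral>\<^sup>+t. ennreal (normal_density 0 (sqrt v) (a - (0 + - w * t)) * normal_density 0 \<bar>w\<bar> (0 + - w * t)) \<partial>lborel)"
    using False by (subst nn_integral_real_affine[where c = "- w" and t = 0]) simp_all
  also have "\<dots> = (\<integral>\<^sup>+t. ennreal \<bar>w\<bar> * ennreal (normal_density 0 (sqrt v) (a - (0 + - w * t)) * normal_density 0 \<bar>w\<bar> (0 + - w * t)) \<partial>lborel)"
    by (rule nn_integral_cmult[symmetric]) simp
  also have "\<dots> = (\<integral>\<^sup>+t. ennreal (std_normal_density t) * ennreal (normal_density 0 (sqrt v) (a + t * w)) \<partial>lborel)"
  proof (rule nn_integral_cong)
    fix t
    have "\<bar>w\<bar> * (normal_density 0 (sqrt v) (a - (0 + - w * t)) * normal_density 0 \<bar>w\<bar> (0 + - w * t))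
        = std_normal_density t * normal_density 0 (sqrt v) (a + t * w)"
      using False by (simp add: normal_density_std_scale mult.commute[of t w])
    then show "ennreal \<bar>w\<bar> * ennreal (normal_density 0 (sqrt v) (a - (0 + - w * t)) * normal_density 0 \<bar>w\<bar> (0 + - w * t))
        = ennreal (std_normal_density t) * ennreal (normal_density 0 (sqrt v) (a + t * w))"
      by (simp flip: ennreal_mult)
  qed
  also have "\<dots> = (\<integral>\<^sup>+y. ennreal (normal_density 0 (sqrt v) (a + y * w)) \<partial>std_normal)"
    by (rule nn_integral_std_normal[symmetric]) simp
  finally show ?thesis ..
qed

lemma nn_integral_std_normal_density_linear_combination:
  assumes "finite B"
  shows "(\<integral>\<^sup>+\<rho>. ennreal (std_normal_density (a + (\<Sum>b\<in>B. \<rho> b * w b))) \<partial>PiM B (\<lambda>_. std_normal))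
      = ennreal (normal_density 0 (sqrt (1 + (\<Sum>b\<in>B. (w b)\<^sup>2))) a)"
  using assms
proof (induction B arbitrary: a rule: finite_induct)
  case empty
  then show ?case by (simp add: space_PiM)
next
  case (insert b B)
  have eq: "(\<Sum>x\<in>insert b B. (\<rho>(b := y)) x * w x) = y * w b + (\<Sum>x\<in>B. \<rho> x * w x)" for \<rho> y
    using insert(1,2) by (simp add: sum.insert) (intro sum.cong; auto)
  have [measurable]: "(\<lambda>\<rho>. ennreal (std_normal_density (a + (\<Sum>x\<in>insert b B. \<rho> x * w x)))) \<in> borel_measurable (PiM (insert b B) (\<lambda>_. std_normal))"
    by measurable
  have "(\<integral>\<^sup>+\<rho>. ennreal (std_normal_density (a + (\<Sum>x\<in>insert b B. \<rho> x * w x))) \<partial>PiM (insert b B) (\<lambda>_. std_normal))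
     = (\<integral>\<^sup>+y. (\<integral>\<^sup>+\<rho>. ennreal (std_normal_density ((a + y * w b) + (\<Sum>x\<in>B. \<rho> x * w x))) \<partial>PiM B (\<lambda>_. std_normal)) \<partial>std_normal)"
    by (subst std_normal_product.product_nn_integral_insert_rev[OF insert(1,2)]) (simp_all only: eq add.assoc, measurable)
  also have "\<dots> = (\<integral>\<^sup>+y. ennreal (normal_density 0 (sqrt (1 + (\<Sum>b\<in>B. (w b)\<^sup>2))) (a + y * w b)) \<partial>std_normal)"
    by (simp only: insert.IH)
  also have "\<dots> = ennreal (normal_density 0 (sqrt (1 + (\<Sum>b\<in>B. (w b)\<^sup>2) + (w b)\<^sup>2)) a)"
    by (rule nn_integral_normal_density_shift) (simp add: add_pos_nonneg sum_nonneg)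
  finally show ?case using insert(1,2) by (simp add: add_ac)
qed

text \<open>
  The product of \<open>\<phi>(y)\<close> and the density at \<open>y w\<close> is a multiple of a centered Gaussian density in \<open>y\<close>, of standard
  deviation \<open>c = sqrt (v / (v + w^2))\<close>; after rescaling by \<open>c\<close> the first absolute moment \<open>sqrt (2 / \<pi>)\<close> remains.
\<close>
lemma nn_integral_abs_normal_density:
  assumes v: "v > 0"
  shows "(\<integral>\<^sup>+y. ennreal \<bar>y\<bar> * ennreal (normal_density 0 (sqrt v) (y * w)) \<partial>std_normal)
      = ennreal (sqrt v / (pi * (v + w\<^sup>2)))"
proof -
  define c where "c = sqrt (v / (v + w\<^sup>2))"
  have c: "c > 0" using v by (simp add: c_def add_pos_nonneg)
  have c2: "c\<^sup>2 = v / (v + w\<^sup>2)" using v by (simp add: c_def add_pos_nonneg)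
  have moment: "(\<integral>\<^sup>+y. ennreal (std_normal_density y * \<bar>y\<bar>) \<partial>lborel) = ennreal (sqrt (2 / pi))"
    using nn_integral_eq_integral[of lborel "\<lambda>y. std_normal_density y * \<bar>y\<bar>"] std_normal_moment_abs_odd[of 0]
    by (simp add: has_bochner_integral_iff)
  have point: "std_normal_density (c * t) * normal_density 0 (sqrt v) (c * t * w) = std_normal_density t / sqrt (2 * pi * v)" for t
  proof -
    have e: "(c * t)\<^sup>2 / 2 + (c * t * w)\<^sup>2 / (2 * v) = t\<^sup>2 / 2"
    proof -
      have "(c * t)\<^sup>2 / 2 + (c * t * w)\<^sup>2 / (2 * v) = c\<^sup>2 * ((v + w\<^sup>2) / v) * t\<^sup>2 / 2"
        using v by (simp add: field_simps power_mult_distrib)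
      also have "c\<^sup>2 * ((v + w\<^sup>2) / v) = 1"
        unfolding c2 using v add_pos_nonneg[OF v zero_le_power2[of w]] by simp
      finally show ?thesis by simp
    qed
    have "exp (- (c * t)\<^sup>2 / 2) * exp (- (c * t * w)\<^sup>2 / (2 * v)) = exp (- t\<^sup>2 / 2)"
      unfolding exp_add[symmetric] using e by (intro arg_cong[where f = exp]) simp
    then show ?thesis using v
      by (simp add: normal_density_def real_sqrt_mult field_simps)
  qed
  have "(\<integral>\<^sup>+y. ennreal \<bar>y\<bar> * ennreal (normal_density 0 (sqrt v) (y * w)) \<partial>std_normal)
      = (\<integral>\<^sup>+y. ennreal (\<bar>y\<bar> * (std_normal_density y * normal_density 0 (sqrt v) (y * w))) \<partial>lborel)"
    by (subst nn_integral_std_normal) (simp_all add: mult_ac flip: ennreal_mult)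
  also have "\<dots> = \<bar>c\<bar> * (\<integral>\<^sup>+t. ennreal (\<bar>0 + c * t\<bar> * (std_normal_density (0 + c * t) * normal_density 0 (sqrt v) ((0 + c * t) * w))) \<partial>lborel)"
    using c by (intro nn_integral_real_affine) simp_all
  also have "\<dots> = ennreal c * (\<integral>\<^sup>+t. ennreal (c / sqrt (2 * pi * v)) * ennreal (std_normal_density t * \<bar>t\<bar>) \<partial>lborel)"
  proof -
    have pt: "\<bar>0 + c * t\<bar> * (std_normal_density (0 + c * t) * normal_density 0 (sqrt v) ((0 + c * t) * w))
        = c / sqrt (2 * pi * v) * (std_normal_density t * \<bar>t\<bar>)" for t
      using c by (simp add: point abs_mult)
    have "ennreal (\<bar>0 + c * t\<bar> * (std_normal_density (0 + c * t) * normal_density 0 (sqrt v) ((0 + c * t) * w)))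
        = ennreal (c / sqrt (2 * pi * v)) * ennreal (std_normal_density t * \<bar>t\<bar>)" for t
      unfolding pt using c v by (intro ennreal_mult) auto
    then show ?thesis by (simp only: abs_of_pos[OF c])
  qed
  also have "\<dots> = ennreal c * (ennreal (c / sqrt (2 * pi * v)) * ennreal (sqrt (2 / pi)))"
    by (subst nn_integral_cmult) (simp_all add: moment)
  also have "\<dots> = ennreal (c\<^sup>2 * sqrt (2 / pi) / sqrt (2 * pi * v))"
    using c v by (simp add: power2_eq_square flip: ennreal_mult)
  also have "c\<^sup>2 * sqrt (2 / pi) / sqrt (2 * pi * v) = sqrt v / (pi * (v + w\<^sup>2))"
  proof -
    have k: "sqrt (2 / pi) / sqrt (2 * pi * v) = 1 / (pi * sqrt v)"
      using v by (simp add: real_sqrt_mult real_sqrt_divide field_simps)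
    have "c\<^sup>2 * sqrt (2 / pi) / sqrt (2 * pi * v) = v / (v + w\<^sup>2) * (sqrt (2 / pi) / sqrt (2 * pi * v))"
      by (simp add: c2)
    also have "\<dots> = (v / sqrt v) / (pi * (v + w\<^sup>2))"
      unfolding k by (simp add: mult_ac)
    also have "v / sqrt v = sqrt v" using v by (simp add: real_div_sqrt)
    finally show ?thesis .
  qed
  finally show ?thesis .
qed

text \<open>
  Integrating out all coefficients but that of \<open>\<tau>\<close> leaves a Gaussian of variance \<open>1 + s\<close> with
  \<open>s = (\<Sum>b\<noteq>\<tau>. (w b)^2)\<close>, and the integral is exactly \<open>r / (\<pi> (r^2 + (w \<tau>)^2))\<close> for \<open>r = sqrt (1 + s)\<close>. This decreases
  in \<open>r \<ge> 1\<close> as soon as \<open>\<bar>w \<tau>\<bar> \<le> 1\<close>: it is here that dominance of the selected term enters.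
\<close>
lemma nn_integral_abs_times_density_le:
  assumes B: "finite B" "\<tau> \<in> B" and w: "\<bar>w \<tau>\<bar> \<le> 1"
  shows "(\<integral>\<^sup>+\<rho>. ennreal (\<bar>\<rho> \<tau>\<bar> * std_normal_density (\<Sum>b\<in>B. \<rho> b * w b)) \<partial>PiM B (\<lambda>_. std_normal))
     \<le> ennreal (1 / (pi * (1 + (w \<tau>)\<^sup>2)))"
proof -
  define B' where "B' = B - {\<tau>}"
  have B': "finite B'" "\<tau> \<notin> B'" "B = insert \<tau> B'" using B by (auto simp: B'_def)
  define s where "s = (\<Sum>b\<in>B'. (w b)\<^sup>2)"
  have s: "s \<ge> 0" unfolding s_def by (simp add: sum_nonneg)
  have eq: "(\<Sum>x\<in>B. (\<rho>(\<tau> := y)) x * w x) = y * w \<tau> + (\<Sum>x\<in>B'. \<rho> x * w x)" for \<rho> y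
    using B'(1,2) unfolding B'(3) by (simp add: sum.insert) (intro sum.cong; auto)
  have [measurable]: "\<tau> \<in> B" by fact
  have "(\<integral>\<^sup>+\<rho>. ennreal (\<bar>\<rho> \<tau>\<bar> * std_normal_density (\<Sum>b\<in>B. \<rho> b * w b)) \<partial>PiM B (\<lambda>_. std_normal))
      = (\<integral>\<^sup>+y. (\<integral>\<^sup>+\<rho>. ennreal \<bar>y\<bar> * ennreal (std_normal_density (y * w \<tau> + (\<Sum>x\<in>B'. \<rho> x * w x))) \<partial>PiM B' (\<lambda>_. std_normal)) \<partial>std_normal)"
    unfolding B'(3)
    by (subst std_normal_product.product_nn_integral_insert_rev[OF B'(1,2)])
      (simp_all only: eq[unfolded B'(3)] fun_upd_same ennreal_mult abs_ge_zero normal_density_nonneg, measurable)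
  also have "\<dots> = (\<integral>\<^sup>+y. ennreal \<bar>y\<bar> * ennreal (normal_density 0 (sqrt (1 + s)) (y * w \<tau>)) \<partial>std_normal)"
    by (subst nn_integral_cmult) (simp_all add: nn_integral_std_normal_density_linear_combination[OF B'(1)] s_def)
  also have "\<dots> = ennreal (sqrt (1 + s) / (pi * (1 + s + (w \<tau>)\<^sup>2)))"
    using s by (intro nn_integral_abs_normal_density) simp
  also have "\<dots> \<le> ennreal (1 / (pi * (1 + (w \<tau>)\<^sup>2)))"
  proof (rule ennreal_leI)
    define p where "p = (w \<tau>)\<^sup>2"
    have p: "0 \<le> p" "p \<le> 1" using w by (auto simp: p_def abs_square_le_1)
    define r where "r = sqrt (1 + s)"
    have r: "r \<ge> 1" "r\<^sup>2 = 1 + s" using s by (auto simp: r_def)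
    \<comment> \<open>With \<open>p = (w \<tau>)^2\<close>, the claim \<open>r (1 + p) \<le> r^2 + p\<close> is \<open>(r - 1) (r - p) \<ge> 0\<close>.\<close>
    have "0 \<le> (r - 1) * (r - p)" using r p by (intro mult_nonneg_nonneg) auto
    then have "r * (1 + p) \<le> r\<^sup>2 + p" by (simp add: algebra_simps power2_eq_square)
    moreover have "r\<^sup>2 + p > 0" "1 + p > 0" using r p by (simp_all add: s add_pos_nonneg)
    moreover have "r * Y \<le> X \<Longrightarrow> 0 < X \<Longrightarrow> 0 < Y \<Longrightarrow> r / X \<le> 1 / Y" for X Y
      by (simp add: field_simps)
    ultimately have "r / (r\<^sup>2 + p) \<le> 1 / (1 + p)"
      by blast
    then have "r / (r\<^sup>2 + p) / pi \<le> 1 / (1 + p) / pi" by (rule divide_right_mono) simp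
    then show "sqrt (1 + s) / (pi * (1 + s + (w \<tau>)\<^sup>2)) \<le> 1 / (pi * (1 + (w \<tau>)\<^sup>2))"
      using s by (simp add: r_def p_def mult_ac)
  qed
  finally show ?thesis .
qed

section \<open>Integrals over all equations\<close>

text \<open>
  Functions of disjoint groups of coordinates are independent.
\<close>
lemma (in product_sigma_finite) product_nn_integral_groups:
  assumes L: "finite L" "\<And>k. k \<in> L \<Longrightarrow> finite (K k)" "disjoint_family_on K L"
    and G: "\<And>k. k \<in> L \<Longrightarrow> G k \<in> borel_measurable (PiM (K k) M)"
  shows "(\<integral>\<^sup>+\<rho>. (\<Prod>k\<in>L. G k (restrict \<rho> (K k))) \<partial>PiM (\<Union>k\<in>L. K k) M) = (\<Prod>k\<in>L. \<integral>\<^sup>+\<rho>. G k \<rho> \<partial>PiM (K k) M)"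
  using assms
proof (induction L rule: finite_induct)
  case empty
  then show ?case by (simp add: space_PiM)
next
  case (insert k L)
  let ?J = "\<Union>k\<in>L. K k"
  have fin: "finite (K k)" "finite ?J" using insert by auto
  have disj: "K k \<inter> ?J = {}" and dL: "disjoint_family_on K L"
    using insert.prems(2) insert(2) by (auto simp: disjoint_family_on_def)
  have meas: "(\<lambda>\<rho>. \<Prod>j\<in>X. G j (restrict \<rho> (K j))) \<in> borel_measurable (PiM Y M)"
    if "X \<subseteq> insert k L" "(\<Union>j\<in>X. K j) \<subseteq> Y" for X Y
  proof (rule borel_measurable_prod_ennreal)
    fix j assume j: "j \<in> X"
    then have m: "(\<lambda>\<rho>. restrict \<rho> (K j)) \<in> PiM Y M \<rightarrow>\<^sub>M PiM (K j) M"
      using that by (intro measurable_restrict_subset) auto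
    show "(\<lambda>\<rho>. G j (restrict \<rho> (K j))) \<in> borel_measurable (PiM Y M)"
      by (rule measurable_compose[OF m insert.prems(3)]) (use j that in auto)
  qed
  have "(\<integral>\<^sup>+\<rho>. (\<Prod>j\<in>insert k L. G j (restrict \<rho> (K j))) \<partial>PiM (\<Union>j\<in>insert k L. K j) M)
      = (\<integral>\<^sup>+x. (\<integral>\<^sup>+y. (\<Prod>j\<in>insert k L. G j (restrict (merge (K k) ?J (x, y)) (K j))) \<partial>PiM ?J M) \<partial>PiM (K k) M)"
    unfolding UN_insert by (intro product_nn_integral_fold[OF disj fin] meas) auto
  also have "\<dots> = (\<integral>\<^sup>+x. (\<integral>\<^sup>+y. G k x * (\<Prod>j\<in>L. G j (restrict y (K j))) \<partial>PiM ?J M) \<partial>PiM (K k) M)"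
  proof (intro nn_integral_cong)
    fix x y assume x: "x \<in> space (PiM (K k) M)" and y: "y \<in> space (PiM ?J M)"
    have "restrict (merge (K k) ?J (x, y)) (K k) = x"
      using x by (auto simp: fun_eq_iff merge_def space_PiM PiE_def extensional_def)
    moreover have "restrict (merge (K k) ?J (x, y)) (K j) = restrict y (K j)" if "j \<in> L" for j
      using that disj by (auto simp: fun_eq_iff merge_def)
    ultimately show "(\<Prod>j\<in>insert k L. G j (restrict (merge (K k) ?J (x, y)) (K j))) = G k x * (\<Prod>j\<in>L. G j (restrict y (K j)))"
      using insert(1,2) by simp
  qed
  also have "\<dots> = (\<integral>\<^sup>+x. G k x * (\<Prod>j\<in>L. \<integral>\<^sup>+\<rho>. G j \<rho> \<partial>PiM (K j) M) \<partial>PiM (K k) M)"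
  proof -
    have IH: "(\<integral>\<^sup>+\<rho>. (\<Prod>j\<in>L. G j (restrict \<rho> (K j))) \<partial>PiM ?J M) = (\<Prod>j\<in>L. \<integral>\<^sup>+\<rho>. G j \<rho> \<partial>PiM (K j) M)"
      by (rule insert.IH) (use insert.prems dL in auto)
    show ?thesis unfolding IH[symmetric] by (intro nn_integral_cong nn_integral_cmult meas) auto
  qed
  also have "\<dots> = (\<Prod>j\<in>insert k L. \<integral>\<^sup>+\<rho>. G j \<rho> \<partial>PiM (K j) M)"
    using insert(1,2) insert.prems(3)[of k] by (subst nn_integral_multc) auto
  finally show ?case .
qed

lemma nn_integral_std_normal_groups_le:
  fixes w :: "'k::finite \<Rightarrow> 'b \<Rightarrow> real"
  assumes A: "\<And>k. finite (A k)" "\<And>k. \<tau> k \<in> A k" and w: "\<And>k. \<bar>w k (\<tau> k)\<bar> \<le> 1"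
  shows "(\<integral>\<^sup>+\<rho>. ennreal (\<Prod>k\<in>UNIV. \<bar>\<rho> (k, \<tau> k)\<bar> * std_normal_density (\<Sum>\<alpha>\<in>A k. \<rho> (k, \<alpha>) * w k \<alpha>))
            \<partial>PiM (SIGMA k:UNIV. A k) (\<lambda>_. std_normal))
     \<le> ennreal (\<Prod>k\<in>UNIV. 1 / (pi * (1 + (w k (\<tau> k))\<^sup>2)))"
proof -
  define K where "K k = {k} \<times> A k" for k
  define G where "G k \<rho> = ennreal (\<bar>\<rho> (k, \<tau> k)\<bar> * std_normal_density (\<Sum>p\<in>K k. \<rho> p * w k (snd p)))" for k \<rho>
  have R: "(SIGMA k:UNIV. A k) = (\<Union>k\<in>UNIV. K k)" by (auto simp: K_def)
  have fin: "finite (K k)" for k by (simp add: K_def A)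
  have mem: "(k, \<tau> k) \<in> K k" for k by (simp add: K_def A)
  have Gm: "G k \<in> borel_measurable (PiM (K k) (\<lambda>_. std_normal))" for k
  proof -
    have [measurable]: "(k, \<tau> k) \<in> K k" by (rule mem)
    show ?thesis unfolding G_def by measurable
  qed
  have G: "G k (restrict \<rho> (K k)) = ennreal (\<bar>\<rho> (k, \<tau> k)\<bar> * std_normal_density (\<Sum>\<alpha>\<in>A k. \<rho> (k, \<alpha>) * w k \<alpha>))" for k \<rho>
  proof -
    have "(\<Sum>p\<in>K k. restrict \<rho> (K k) p * w k (snd p)) = (\<Sum>\<alpha>\<in>A k. \<rho> (k, \<alpha>) * w k \<alpha>)"
      by (rule sum.reindex_bij_witness[of _ "\<lambda>\<alpha>. (k, \<alpha>)" snd]) (auto simp: K_def)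
    then show ?thesis using mem by (simp add: G_def)
  qed
  have "(\<integral>\<^sup>+\<rho>. ennreal (\<Prod>k\<in>UNIV. \<bar>\<rho> (k, \<tau> k)\<bar> * std_normal_density (\<Sum>\<alpha>\<in>A k. \<rho> (k, \<alpha>) * w k \<alpha>))
            \<partial>PiM (SIGMA k:UNIV. A k) (\<lambda>_. std_normal))
      = (\<integral>\<^sup>+\<rho>. (\<Prod>k\<in>UNIV. G k (restrict \<rho> (K k))) \<partial>PiM (\<Union>k\<in>UNIV. K k) (\<lambda>_. std_normal))"
    unfolding R by (simp add: G prod_ennreal)
  also have "\<dots> = (\<Prod>k\<in>UNIV. \<integral>\<^sup>+\<rho>. G k \<rho> \<partial>PiM (K k) (\<lambda>_. std_normal))"
    by (rule std_normal_product.product_nn_integral_groups[OF _ fin _ Gm]) (auto simp: disjoint_family_on_def K_def)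
  also have "\<dots> \<le> (\<Prod>k\<in>UNIV. ennreal (1 / (pi * (1 + (w k (\<tau> k))\<^sup>2))))"
    using nn_integral_abs_times_density_le[OF fin mem, of "\<lambda>p. w _ (snd p)"] w
    by (intro prod_mono_ennreal) (simp add: G_def)
  also have "\<dots> = ennreal (\<Prod>k\<in>UNIV. 1 / (pi * (1 + (w k (\<tau> k))\<^sup>2)))"
    by (rule prod_ennreal) (simp add: add_nonneg_nonneg)
  finally show ?thesis .
qed

lemma nn_integral_lborel_prod_vec:
  fixes f :: "'n::finite \<Rightarrow> real \<Rightarrow> ennreal"
  assumes [measurable]: "\<And>k. f k \<in> borel_measurable borel"
  shows "(\<integral>\<^sup>+z. (\<Prod>k\<in>UNIV. f k (z $ k)) \<partial>lborel) = (\<Prod>k\<in>UNIV. \<integral>\<^sup>+x. f k x \<partial>lborel)"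
proof -
  define ix where "ix b = (THE k. b = axis k (1::real))" for b :: "real^'n"
  have ix: "ix (axis k 1) = k" for k by (auto simp: ix_def axis_eq_axis)
  have B: "(Basis :: (real^'n) set) = (\<lambda>k. axis k 1) ` UNIV" by (auto simp: Basis_vec_def)
  have inj: "inj (\<lambda>k::'n. axis k (1::real))" by (simp add: inj_on_def axis_eq_axis)
  have "(\<integral>\<^sup>+z. (\<Prod>b\<in>Basis. f (ix b) (z \<bullet> b)) \<partial>lborel) = (\<Prod>b\<in>Basis. \<integral>\<^sup>+x. f (ix b) x \<partial>lborel)"
    by (rule nn_integral_lborel_prod) simp_all
  then show ?thesis unfolding B by (simp add: prod.reindex[OF inj] comp_def ix inner_axis)
qed

text \<open>
  Coefficients indexed by the graph of \<open>s\<close> are read as a vector, with the standard Gaussian density with respect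
  to Lebesgue measure; in this form the area formula applies to them.
\<close>
lemma nn_integral_PiM_std_normal_graph:
  fixes s :: "'n::finite \<Rightarrow> 'b" and F :: "('n \<times> 'b \<Rightarrow> real) \<Rightarrow> ennreal"
  defines "D \<equiv> range (\<lambda>k. (k, s k))"
  assumes F: "F \<in> borel_measurable (PiM D (\<lambda>_. std_normal))"
  shows "(\<integral>\<^sup>+\<eta>. F \<eta> \<partial>PiM D (\<lambda>_. std_normal))
     = (\<integral>\<^sup>+z. ennreal (\<Prod>k\<in>UNIV. std_normal_density (z $ k)) * F (\<lambda>p\<in>D. z $ fst p) \<partial>(lborel :: (real^'n) measure))"
proof -
  let ?N = "density lborel (\<lambda>z :: real^'n. ennreal (\<Prod>k\<in>UNIV. std_normal_density (z $ k)))"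
  let ?\<psi> = "\<lambda>z :: real^'n. \<lambda>p\<in>D. z $ fst p"
  have \<psi>: "?\<psi> \<in> ?N \<rightarrow>\<^sub>M PiM D (\<lambda>_. std_normal)"
    by (rule measurable_restrict) simp
  then have \<psi>': "?\<psi> \<in> lborel \<rightarrow>\<^sub>M PiM D (\<lambda>_. std_normal)" by simp
  have inj: "inj (\<lambda>k. (k, s k))" by (simp add: inj_on_def)
  have law: "distr ?N (PiM D (\<lambda>_. std_normal)) ?\<psi> = PiM D (\<lambda>_. std_normal)"
  proof (rule std_normal_product.PiM_eqI)
    fix A :: "'n \<times> 'b \<Rightarrow> real set" assume A: "\<And>i. i \<in> D \<Longrightarrow> A i \<in> sets std_normal"
    then have Am[measurable]: "A (k, s k) \<in> sets borel" for k by (auto simp: D_def)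
    have "emeasure (distr ?N (PiM D (\<lambda>_. std_normal)) ?\<psi>) (Pi\<^sub>E D A) = emeasure ?N (?\<psi> -` (Pi\<^sub>E D A) \<inter> space ?N)"
      using A by (intro emeasure_distr \<psi> sets_PiM_I_finite) (simp_all add: D_def)
    also have "?\<psi> -` (Pi\<^sub>E D A) \<inter> space ?N = {z. \<forall>k. z $ k \<in> A (k, s k)}"
      by (auto simp: D_def PiE_iff Pi_iff)
    also have "emeasure ?N {z. \<forall>k. z $ k \<in> A (k, s k)}
       = (\<integral>\<^sup>+z. ennreal (\<Prod>k\<in>UNIV. std_normal_density (z $ k)) * indicator {z. \<forall>k. z $ k \<in> A (k, s k)} z \<partial>lborel)"
      by (rule emeasure_density) measurable
    also have "\<dots> = (\<integral>\<^sup>+z. (\<Prod>k\<in>UNIV. ennreal (std_normal_density (z $ k)) * indicator (A (k, s k)) (z $ k)) \<partial>lborel)"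
    proof (rule nn_integral_cong)
      fix z :: "real^'n"
      have "indicator {z. \<forall>k. z $ k \<in> A (k, s k)} z = (\<Prod>k\<in>UNIV. indicator (A (k, s k)) (z $ k) :: ennreal)"
        by (auto simp: indicator_def prod_zero_iff)
      then show "ennreal (\<Prod>k\<in>UNIV. std_normal_density (z $ k)) * indicator {z. \<forall>k. z $ k \<in> A (k, s k)} z
         = (\<Prod>k\<in>UNIV. ennreal (std_normal_density (z $ k)) * indicator (A (k, s k)) (z $ k))"
        by (simp add: prod.distrib prod_ennreal)
    qed
    also have "\<dots> = (\<Prod>k\<in>UNIV. \<integral>\<^sup>+x. ennreal (std_normal_density x) * indicator (A (k, s k)) x \<partial>lborel)"
      by (rule nn_integral_lborel_prod_vec) measurable
    also have "\<dots> = (\<Prod>k\<in>UNIV. emeasure std_normal (A (k, s k)))"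
      by (intro prod.cong refl emeasure_density[symmetric]) measurable
    also have "\<dots> = (\<Prod>i\<in>D. emeasure std_normal (A i))"
      unfolding D_def by (simp add: prod.reindex[OF inj])
    finally show "emeasure (distr ?N (PiM D (\<lambda>_. std_normal)) ?\<psi>) (Pi\<^sub>E D A) = (\<Prod>i\<in>D. emeasure std_normal (A i))" .
  qed (simp_all add: D_def)
  have "(\<integral>\<^sup>+\<eta>. F \<eta> \<partial>PiM D (\<lambda>_. std_normal)) = (\<integral>\<^sup>+\<eta>. F \<eta> \<partial>distr ?N (PiM D (\<lambda>_. std_normal)) ?\<psi>)"
    by (simp only: law)
  also have "\<dots> = (\<integral>\<^sup>+z. F (?\<psi> z) \<partial>?N)"
    using F by (intro nn_integral_distr \<psi>) simp
  also have "\<dots> = (\<integral>\<^sup>+z. ennreal (\<Prod>k\<in>UNIV. std_normal_density (z $ k)) * F (?\<psi> z) \<partial>lborel)"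
    using measurable_compose[OF \<psi>' F] by (intro nn_integral_density) simp_all
  finally show ?thesis .
qed

text \<open>
  The standard Cauchy density on the positive half-line in the coordinate \<open>u = - ln t\<close>. The half-line
  \<open>u \<ge> 0\<close> corresponds to \<open>0 < t \<le> 1\<close>, a quarter of the Cauchy distribution.
\<close>
definition exp_cauchy_density :: "real \<Rightarrow> real" where
  "exp_cauchy_density u = exp (- u) / (pi * (1 + (exp (- u))\<^sup>2))"

lemma exp_cauchy_density_nonneg: "0 \<le> exp_cauchy_density u"
  by (simp add: exp_cauchy_density_def)

lemma measurable_exp_cauchy_density [measurable]: "exp_cauchy_density \<in> borel_measurable borel"
  unfolding exp_cauchy_density_def[abs_def] by measurable

lemma nn_integral_exp_cauchy_density:
  "(\<integral>\<^sup>+u. ennreal (exp_cauchy_density u) * indicator {0..} u \<partial>lborel) = ennreal (1 / 4)"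
proof -
  let ?F = "\<lambda>u. - arctan (exp (- u)) / pi"
  have "DERIV ?F u :> exp_cauchy_density u" for u
    unfolding exp_cauchy_density_def
    by (auto intro!: derivative_eq_intros simp: field_simps) (simp flip: distrib_left)
  moreover have "(?F \<longlongrightarrow> - arctan 0 / pi) at_top"
    by (intro tendsto_intros filterlim_compose[OF exp_at_bot] filterlim_uminus_at_bot_at_top) simp_all
  ultimately have "(\<integral>\<^sup>+u. ennreal (exp_cauchy_density u) * indicator {0..} u \<partial>lborel) = ennreal (- arctan 0 / pi - ?F 0)"
    by (intro nn_integral_FTC_atLeast) (simp_all add: exp_cauchy_density_nonneg)
  then show ?thesis by (simp add: arctan_one)
qed

text \<open>
  In the coordinates \<open>u\<^sub>k = b k + a k \<bullet> y\<close> the integrand is a product of functions of one variable on the orthant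
  \<open>u \<ge> 0\<close>, each with integral \<open>1 / 4\<close>. If the coordinate change is singular, the integrand vanishes.
\<close>
lemma nn_integral_affine_exp_cauchy_le:
  fixes a :: "'n::finite \<Rightarrow> real^'n" and b :: "'n \<Rightarrow> real"
  shows "(\<integral>\<^sup>+y. ennreal (\<bar>det (\<chi> k. a k)\<bar> * (\<Prod>k\<in>UNIV. exp_cauchy_density (b k + a k \<bullet> y)))
            * indicator {y. \<forall>k. 0 \<le> b k + a k \<bullet> y} y \<partial>lborel) \<le> ennreal ((1 / 4) ^ CARD('n))"
proof (cases "det (\<chi> k. a k) = 0")
  case False
  define g where "g y = (\<chi> k. b k + a k \<bullet> y)" for y
  define f where "f z = (\<Prod>k\<in>UNIV. exp_cauchy_density (z $ k) * indicator {0..} (z $ k))" for z :: "real^'n"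
  have f0: "0 \<le> f z" for z unfolding f_def by (intro prod_nonneg) (simp add: exp_cauchy_density_nonneg)
  have [measurable]: "f \<in> borel_measurable borel" unfolding f_def[abs_def] by measurable
  have fint: "(\<integral>\<^sup>+z. ennreal (f z) \<partial>lborel) = ennreal ((1 / 4) ^ CARD('n))"
  proof -
    have "ennreal (f z) = (\<Prod>k\<in>UNIV. ennreal (exp_cauchy_density (z $ k)) * indicator {0..} (z $ k))" for z
      unfolding f_def by (subst prod_ennreal[symmetric])
        (auto simp: exp_cauchy_density_nonneg ennreal_mult ennreal_indicator)
    then have "(\<integral>\<^sup>+z. ennreal (f z) \<partial>lborel) = (\<Prod>k\<in>(UNIV::'n set). ennreal (1 / 4))"
      by (simp only: nn_integral_exp_cauchy_density[symmetric]) (rule nn_integral_lborel_prod_vec; measurable)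
    then show ?thesis by (simp add: ennreal_power)
  qed
  have "integrable lborel f"
    using f0 fint by (intro integrableI_nonneg) simp_all
  note f = this f0
  have lin: "(\<chi> k. a k) *v y = (\<chi> k. a k \<bullet> y)" for y
    by (simp add: matrix_vector_mul_component vec_eq_iff)
  have dg: "(g has_derivative (*v) (\<chi> k. a k)) (at y)" for y
  proof -
    have "g = (\<lambda>y. (\<chi> k. b k) + (\<chi> k. a k) *v y)" by (simp add: fun_eq_iff g_def lin vec_eq_iff)
    then show ?thesis
      by (auto intro!: derivative_eq_intros bounded_linear_imp_has_derivative matrix_vector_mul_bounded_linear)
  qed
  have inj: "inj_on g UNIV"
  proof (rule inj_onI)
    fix x y assume "g x = g y"
    then have "(\<chi> k. a k) *v x = (\<chi> k. a k) *v y" unfolding lin by (simp add: g_def vec_eq_iff)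
    then show "x = y" using False by (metis inj_matrix_vector_mult invertible_det_nz injD)
  qed
  have "(\<integral>\<^sup>+y. ennreal (\<bar>det (\<chi> k. a k)\<bar> * (\<Prod>k\<in>UNIV. exp_cauchy_density (b k + a k \<bullet> y)))
            * indicator {y. \<forall>k. 0 \<le> b k + a k \<bullet> y} y \<partial>lborel)
      = (\<integral>\<^sup>+y. ennreal (\<bar>det (\<chi> k. a k)\<bar> * f (g y)) * indicator UNIV y \<partial>lborel)"
  proof (rule nn_integral_cong)
    fix y
    have "f (g y) = (\<Prod>k\<in>UNIV. exp_cauchy_density (b k + a k \<bullet> y)) * indicator {y. \<forall>k. 0 \<le> b k + a k \<bullet> y} y"
      by (auto simp: f_def g_def prod.distrib indicator_def prod_zero_iff)
    then show "ennreal (\<bar>det (\<chi> k. a k)\<bar> * (\<Prod>k\<in>UNIV. exp_cauchy_density (b k + a k \<bullet> y)))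
        * indicator {y. \<forall>k. 0 \<le> b k + a k \<bullet> y} y
      = ennreal (\<bar>det (\<chi> k. a k)\<bar> * f (g y)) * indicator UNIV y"
      by (auto simp: indicator_def)
  qed
  also have "\<dots> = (\<integral>\<^sup>+z. ennreal (f z) * indicator (g ` UNIV) z \<partial>lborel)"
    by (rule nn_integral_change_of_variables[OF _ dg _ inj f, symmetric]) simp_all
  also have "\<dots> \<le> (\<integral>\<^sup>+z. ennreal (f z) \<partial>lborel)"
    by (intro nn_integral_mono) (auto simp: indicator_def)
  finally show ?thesis unfolding fint .
qed simp

lemma det_sum_rows_expand:
  fixes a :: "'n::finite \<Rightarrow> 'b \<Rightarrow> real^'n"
  assumes "\<And>i. finite (S i)"
  shows "det (\<chi> i. \<Sum>x\<in>S i. a i x) = (\<Sum>\<tau>\<in>Pi\<^sub>E UNIV S. det (\<chi> i. a i (\<tau> i)))"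
proof -
  have "det (\<chi> i. \<Sum>x\<in>S i. a i x)
     = (\<Sum>p | p permutes UNIV. of_int (sign p) * (\<Prod>i\<in>UNIV. \<Sum>x\<in>S i. a i x $ p i))"
    by (simp add: det_def)
  also have "\<dots> = (\<Sum>p | p permutes UNIV. \<Sum>\<tau>\<in>Pi\<^sub>E UNIV S. of_int (sign p) * (\<Prod>i\<in>UNIV. a i (\<tau> i) $ p i))"
    using assms by (simp add: prod_sum_PiE sum_distrib_left)
  also have "\<dots> = (\<Sum>\<tau>\<in>Pi\<^sub>E UNIV S. det (\<chi> i. a i (\<tau> i)))"
    by (subst sum.swap) (simp add: det_def)
  finally show ?thesis .
qed

section \<open>Exponential sums in a dominance cell\<close>

text \<open>
  The system in logarithmic coordinates. Coefficients of all equations form a single function on pairs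
  \<open>(k, \<alpha>)\<close>, since the family of all of them is what is independent.
\<close>
definition exp_system ::
  "('n \<Rightarrow> (real^'n) set) \<Rightarrow> ('n \<Rightarrow> real^'n \<Rightarrow> real) \<Rightarrow> ('n \<times> (real^'n) \<Rightarrow> real) \<Rightarrow> real^'n \<Rightarrow> real^'n::finite" where
  "exp_system A l c y = (\<chi> k. \<Sum>\<alpha>\<in>A k. c (k, \<alpha>) * exp (l k \<alpha> + \<alpha> \<bullet> y))"

definition exp_jacobian ::
  "('n \<Rightarrow> (real^'n) set) \<Rightarrow> ('n \<Rightarrow> real^'n \<Rightarrow> real) \<Rightarrow> ('n \<times> (real^'n) \<Rightarrow> real) \<Rightarrow> real^'n \<Rightarrow> real^'n::finite^'n" where
  "exp_jacobian A l c y = (\<chi> k i. \<Sum>\<alpha>\<in>A k. c (k, \<alpha>) * exp (l k \<alpha> + \<alpha> \<bullet> y) * \<alpha> $ i)"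

definition exp_regular_zeros ::
  "('n \<Rightarrow> (real^'n) set) \<Rightarrow> ('n \<Rightarrow> real^'n \<Rightarrow> real) \<Rightarrow> (real^'n) set \<Rightarrow> ('n \<times> (real^'n) \<Rightarrow> real) \<Rightarrow> (real^'n::finite) set" where
  "exp_regular_zeros A l C c = {y \<in> C. exp_system A l c y = 0 \<and> det (exp_jacobian A l c y) \<noteq> 0}"

definition dominance_cell ::
  "('n \<Rightarrow> (real^'n) set) \<Rightarrow> ('n \<Rightarrow> real^'n \<Rightarrow> real) \<Rightarrow> ('n \<Rightarrow> real^'n) \<Rightarrow> (real^'n::finite) set" where
  "dominance_cell A l s = {y. \<forall>k. \<forall>\<alpha>\<in>A k. l k \<alpha> + \<alpha> \<bullet> y \<le> l k (s k) + s k \<bullet> y}"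

lemma closed_dominance_cell: "closed (dominance_cell A l s)"
  unfolding dominance_cell_def Ball_def
  by (intro closed_Collect_all closed_Collect_imp open_Collect_const closed_Collect_le continuous_intros)

text \<open>
  The \<open>\<alpha>\<close>-term of equation \<open>k\<close> divided by the selected term, both without their coefficients.
\<close>
definition relative_weight ::
  "('n \<Rightarrow> real^'n \<Rightarrow> real) \<Rightarrow> ('n \<Rightarrow> real^'n) \<Rightarrow> real^'n::finite \<Rightarrow> 'n \<Rightarrow> real^'n \<Rightarrow> real" where
  "relative_weight l s y k \<alpha> = exp (l k \<alpha> + \<alpha> \<bullet> y - (l k (s k) + s k \<bullet> y))"

text \<open>
  The value that the selected coefficients must take for \<open>y\<close> to be a zero, given all other coefficients.
\<close>
definition slice_map ::
  "('n \<Rightarrow> (real^'n) set) \<Rightarrow> ('n \<Rightarrow> real^'n \<Rightarrow> real) \<Rightarrow> ('n \<Rightarrow> real^'n) \<Rightarrow> ('n \<times> (real^'n) \<Rightarrow> real) \<Rightarrow> real^'n \<Rightarrow> real^'n::finite" where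
  "slice_map A l s c y = (\<chi> k. - (\<Sum>\<alpha>\<in>A k - {s k}. c (k, \<alpha>) * relative_weight l s y k \<alpha>))"

definition slice_jacobian ::
  "('n \<Rightarrow> (real^'n) set) \<Rightarrow> ('n \<Rightarrow> real^'n \<Rightarrow> real) \<Rightarrow> ('n \<Rightarrow> real^'n) \<Rightarrow> ('n \<times> (real^'n) \<Rightarrow> real) \<Rightarrow> real^'n \<Rightarrow> real^'n::finite^'n" where
  "slice_jacobian A l s c y = (\<chi> k. \<Sum>\<alpha>\<in>A k - {s k}. (c (k, \<alpha>) * relative_weight l s y k \<alpha>) *s (s k - \<alpha>))"

lemma has_derivative_slice_map:
  "(slice_map A l s c has_derivative (*v) (slice_jacobian A l s c y)) (at y)"
proof -
  have comp: "((\<lambda>y. slice_map A l s c y $ k) has_derivative (\<lambda>h. (slice_jacobian A l s c y *v h) $ k)) (at y)" for k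
  proof -
    have "(slice_jacobian A l s c y *v h) $ k
        = - (\<Sum>\<alpha>\<in>A k - {s k}. c (k, \<alpha>) * (relative_weight l s y k \<alpha> * (\<alpha> \<bullet> h - s k \<bullet> h)))" for h
      by (simp add: matrix_vector_mul_component slice_jacobian_def inner_sum_left scalar_mult_eq_scaleR
          inner_diff_left mult.assoc algebra_simps flip: sum_negf)
    then show ?thesis
      unfolding slice_map_def relative_weight_def
      by (auto intro!: derivative_eq_intros sum.cong simp: algebra_simps)
  qed
  show ?thesis
    unfolding has_derivative_componentwise_within[of "slice_map A l s c"]
    using comp by (auto simp: Basis_vec_def inner_axis)
qed

lemma continuous_on_vec_entries:
  fixes J :: "'a::topological_space \<Rightarrow> real^'n::finite^'n"
  assumes "\<And>i j. continuous_on S (\<lambda>x. J x $ i $ j)"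
  shows "continuous_on S J"
proof -
  have "continuous_on S (\<lambda>x. \<chi> i j. J x $ i $ j)"
    by (intro continuous_on_vec_lambda assms)
  then show ?thesis by simp
qed

lemma continuous_slice_jacobian: "continuous_on UNIV (slice_jacobian A l s c)"
  by (rule continuous_on_vec_entries) (auto simp: slice_jacobian_def relative_weight_def intro!: continuous_intros)

text \<open>
  Equation \<open>k\<close> is its selected term \<open>T k\<close> times \<open>c (k, s k) - g\<^sub>k\<close>, with \<open>g\<close> the slice map. At a zero, the derivative of the
  factor \<open>T k\<close> does not contribute, hence row \<open>k\<close> of the Jacobian is \<open>- T k\<close> times the gradient of \<open>g\<^sub>k\<close>.
\<close>
lemma regular_zeros_slice:
  fixes A :: "'n::finite \<Rightarrow> (real^'n) set"
  assumes fin: "\<And>k. finite (A k)" and s: "\<And>k. s k \<in> A k"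
  shows "exp_regular_zeros A l C c
    = {y \<in> C. slice_map A l s c y = (\<chi> k. c (k, s k)) \<and> det (slice_jacobian A l s c y) \<noteq> 0}"
proof -
  have "exp_system A l c y = 0 \<and> det (exp_jacobian A l c y) \<noteq> 0
     \<longleftrightarrow> slice_map A l s c y = (\<chi> k. c (k, s k)) \<and> det (slice_jacobian A l s c y) \<noteq> 0" for y
  proof -
    define T where "T k = exp (l k (s k) + s k \<bullet> y)" for k
    let ?r = "relative_weight l s y"
    have T: "exp (l k \<alpha> + \<alpha> \<bullet> y) = T k * ?r k \<alpha>" for k \<alpha>
      by (simp add: T_def relative_weight_def flip: exp_add)
    have rs: "?r k (s k) = 1" for k by (simp add: relative_weight_def)
    have T0: "T k \<noteq> 0" for k by (simp add: T_def)
    have split: "(\<Sum>\<alpha>\<in>A k. f \<alpha>) = f (s k) + (\<Sum>\<alpha>\<in>A k - {s k}. f \<alpha>)" for k and f :: "real^'n \<Rightarrow> real"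
      using fin s by (simp add: sum.remove)
    have sys: "exp_system A l c y $ k = T k * (c (k, s k) - slice_map A l s c y $ k)" for k
      by (simp add: exp_system_def slice_map_def T split rs sum_distrib_left distrib_left mult_ac)
    then have zero: "exp_system A l c y = 0 \<longleftrightarrow> slice_map A l s c y = (\<chi> k. c (k, s k))"
      using T0 by (auto simp: vec_eq_iff)
    have det: "det (exp_jacobian A l c y) = (\<Prod>k\<in>UNIV. - T k) * det (slice_jacobian A l s c y)"
      if z: "exp_system A l c y = 0"
    proof -
      have "exp_jacobian A l c y $ k $ i = - T k * slice_jacobian A l s c y $ k $ i" for k i
      proof -
        have "(\<Sum>\<alpha>\<in>A k. c (k, \<alpha>) * (T k * ?r k \<alpha>)) = 0"
          using z by (simp add: exp_system_def vec_eq_iff T)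
        \<comment> \<open>The subtracted sum is zero at a zero of the system; it turns \<open>\<alpha>\<close> into \<open>\<alpha> - s k\<close>.\<close>
        then have "exp_jacobian A l c y $ k $ i
            = (\<Sum>\<alpha>\<in>A k. c (k, \<alpha>) * (T k * ?r k \<alpha>) * \<alpha> $ i) - (\<Sum>\<alpha>\<in>A k. c (k, \<alpha>) * (T k * ?r k \<alpha>)) * s k $ i"
          by (simp add: exp_jacobian_def T)
        also have "\<dots> = (\<Sum>\<alpha>\<in>A k. c (k, \<alpha>) * (T k * ?r k \<alpha>) * (\<alpha> $ i - s k $ i))"
          by (simp add: sum_distrib_right sum_subtractf right_diff_distrib)
        also have "\<dots> = (\<Sum>\<alpha>\<in>A k - {s k}. - T k * (c (k, \<alpha>) * ?r k \<alpha> * (s k $ i - \<alpha> $ i)))"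
          unfolding split by (simp add: algebra_simps)
        also have "\<dots> = - T k * slice_jacobian A l s c y $ k $ i"
          by (simp add: slice_jacobian_def sum_distrib_left right_diff_distrib)
        finally show ?thesis .
      qed
      then have "exp_jacobian A l c y = (\<chi> k. (- T k) *s (slice_jacobian A l s c y $ k))"
        by (simp add: vec_eq_iff)
      then show ?thesis by (simp only: det_rows_mul vec_nth_inverse)
    qed
    have "(\<Prod>k\<in>UNIV. - T k) \<noteq> 0" using T0 by simp
    then show ?thesis using zero det by auto
  qed
  then show ?thesis unfolding exp_regular_zeros_def by blast
qed

lemma measurable_coefficient:
  assumes "p \<in> R"
  shows "(\<lambda>c. c p) \<in> borel_measurable (PiM R (\<lambda>_. std_normal))"
proof -
  have "(\<lambda>c. c p) \<in> PiM R (\<lambda>_. std_normal) \<rightarrow>\<^sub>M std_normal" using assms by (rule measurable_component_singleton)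
  then show ?thesis by simp
qed

lemma measurable_exp_regular_zeros_count:
  fixes A :: "'n::finite \<Rightarrow> (real^'n) set"
  assumes "closed C"
  shows "(\<lambda>c. emeasure (count_space UNIV) (exp_regular_zeros A l C c))
    \<in> borel_measurable (PiM (SIGMA k:UNIV. A k) (\<lambda>_. std_normal))"
  unfolding exp_regular_zeros_def
proof (rule measurable_number_of_regular_zeros[OF assms])
  let ?P = "PiM (SIGMA k:UNIV. A k) (\<lambda>_. std_normal)"
  have m: "(\<lambda>c. c (k, \<alpha>)) \<in> borel_measurable ?P" if "\<alpha> \<in> A k" for k \<alpha>
    using that by (intro measurable_coefficient) simp
  show "continuous_on UNIV (exp_system A l c)" for c
    unfolding exp_system_def by (intro continuous_on_vec_lambda continuous_intros)
  show "continuous_on UNIV (\<lambda>y. det (exp_jacobian A l c y))" for c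
    by (intro continuous_on_det continuous_on_vec_entries) (auto simp: exp_jacobian_def intro!: continuous_intros)
  show "(\<lambda>c. det (exp_jacobian A l c y)) \<in> borel_measurable ?P" for y
    unfolding det_def exp_jacobian_def vec_lambda_beta
    by (intro borel_measurable_sum borel_measurable_times borel_measurable_prod borel_measurable_const m)
  show "(\<lambda>c. exp_system A l c y) \<in> borel_measurable ?P" for y
  proof (subst borel_measurable_euclidean_space, rule ballI)
    fix b :: "real^'n" assume "b \<in> Basis"
    then obtain k where "b = axis k 1" by (auto simp: Basis_vec_def)
    then have "(\<lambda>c. exp_system A l c y \<bullet> b) = (\<lambda>c. \<Sum>\<alpha>\<in>A k. c (k, \<alpha>) * exp (l k \<alpha> + \<alpha> \<bullet> y))"
      by (simp add: exp_system_def inner_axis)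
    then show "(\<lambda>c. exp_system A l c y \<bullet> b) \<in> borel_measurable ?P"
      by (simp only:) (intro borel_measurable_sum borel_measurable_times borel_measurable_const m)
  qed
qed

definition std_normal_density_vec :: "real^'n::finite \<Rightarrow> real" where
  "std_normal_density_vec z = (\<Prod>k\<in>UNIV. std_normal_density (z $ k))"

lemma integrable_std_normal_density_vec: "integrable lborel (std_normal_density_vec :: real^'n::finite \<Rightarrow> real)"
proof (rule integrableI_nonneg)
  have "ennreal (std_normal_density_vec z) = (\<Prod>k\<in>UNIV. ennreal (std_normal_density (z $ k)))" for z :: "real^'n"
    by (simp add: std_normal_density_vec_def prod_ennreal)
  then have "(\<integral>\<^sup>+z. ennreal (std_normal_density_vec z) \<partial>(lborel :: (real^'n) measure))
      = (\<Prod>k\<in>(UNIV::'n set). \<integral>\<^sup>+x. ennreal (std_normal_density x) \<partial>lborel)"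
    by (simp only:) (rule nn_integral_lborel_prod_vec; measurable)
  also have "\<dots> = 1"
    using nn_integral_eq_integral[of lborel std_normal_density] by simp
  finally show "(\<integral>\<^sup>+z. ennreal (std_normal_density_vec z) \<partial>(lborel :: (real^'n) measure)) < \<infinity>" by simp
qed (auto simp: std_normal_density_vec_def[abs_def] prod_nonneg)

section \<open>Expected number of zeros in a cell\<close>

lemma
  assumes "\<And>k \<alpha>. \<alpha> \<in> A k - {s k} \<Longrightarrow> c (k, \<alpha>) = d (k, \<alpha>)"
  shows slice_map_cong: "slice_map A l s c y = slice_map A l s d y"
    and slice_jacobian_cong: "slice_jacobian A l s c y = slice_jacobian A l s d y"
  unfolding slice_map_def slice_jacobian_def vec_eq_iff vec_lambda_beta
  using assms by (auto simp del: Diff_iff intro!: sum.cong arg_cong[where f = uminus] arg_cong[where f = "\<lambda>v. v $ _"])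

text \<open>
  The pointwise bound for the density of the expected number of zeros at \<open>y\<close>: the determinant is expanded
  multilinearly along its rows, and each summand factors over the equations.
\<close>
lemma nn_integral_slice_density_le:
  fixes A :: "'n::finite \<Rightarrow> (real^'n) set"
  assumes fin: "\<And>k. finite (A k)" and y: "y \<in> dominance_cell A l s"
  defines "A' \<equiv> \<lambda>k. A k - {s k}"
  shows "(\<integral>\<^sup>+\<rho>. ennreal (\<bar>det (slice_jacobian A l s \<rho> y)\<bar> * std_normal_density_vec (slice_map A l s \<rho> y))
            \<partial>PiM (SIGMA k:UNIV. A' k) (\<lambda>_. std_normal))
     \<le> (\<Sum>\<tau>\<in>Pi\<^sub>E UNIV A'. ennreal (\<bar>det (\<chi> k. s k - \<tau> k)\<bar> *
          (\<Prod>k\<in>UNIV. exp_cauchy_density (l k (s k) - l k (\<tau> k) + (s k - \<tau> k) \<bullet> y))))"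
proof -
  let ?r = "relative_weight l s y"
  let ?P = "PiM (SIGMA k:UNIV. A' k) (\<lambda>_. std_normal)"
  define H where "H \<tau> \<rho> = (\<Prod>k\<in>UNIV. \<bar>\<rho> (k, \<tau> k)\<bar> * std_normal_density (\<Sum>\<alpha>\<in>A' k. \<rho> (k, \<alpha>) * ?r k \<alpha>))" for \<tau> and \<rho> :: "'n \<times> (real^'n) \<Rightarrow> real"
  define K where "K \<tau> = \<bar>det (\<chi> k. s k - \<tau> k)\<bar> * (\<Prod>k\<in>UNIV. ?r k (\<tau> k))" for \<tau>
  have r0: "0 < ?r k \<alpha>" for k \<alpha> by (simp add: relative_weight_def)
  have r1: "?r k \<alpha> \<le> 1" if "\<alpha> \<in> A' k" for k \<alpha>
    using y that by (auto simp: dominance_cell_def relative_weight_def A'_def)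
  have fin': "finite (A' k)" for k using fin by (simp add: A'_def)
  have K0: "0 \<le> K \<tau>" for \<tau> using r0 by (simp add: K_def prod_nonneg less_imp_le)
  have H0: "0 \<le> H \<tau> \<rho>" for \<tau> \<rho> by (simp add: H_def prod_nonneg)
  have \<phi>: "std_normal_density_vec (slice_map A l s \<rho> y) = (\<Prod>k\<in>UNIV. std_normal_density (\<Sum>\<alpha>\<in>A' k. \<rho> (k, \<alpha>) * ?r k \<alpha>))" for \<rho>
    by (simp add: std_normal_density_vec_def slice_map_def A'_def std_normal_density_def)
  have bound: "\<bar>det (slice_jacobian A l s \<rho> y)\<bar> * std_normal_density_vec (slice_map A l s \<rho> y) \<le> (\<Sum>\<tau>\<in>Pi\<^sub>E UNIV A'. K \<tau> * H \<tau> \<rho>)" for \<rho>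
  proof -
    have "det (slice_jacobian A l s \<rho> y) = (\<Sum>\<tau>\<in>Pi\<^sub>E UNIV A'. det (\<chi> k. (\<rho> (k, \<tau> k) * ?r k (\<tau> k)) *s (s k - \<tau> k)))"
      unfolding slice_jacobian_def A'_def using fin by (intro det_sum_rows_expand) simp
    also have "\<bar>\<dots>\<bar> \<le> (\<Sum>\<tau>\<in>Pi\<^sub>E UNIV A'. \<bar>det (\<chi> k. (\<rho> (k, \<tau> k) * ?r k (\<tau> k)) *s (s k - \<tau> k))\<bar>)"
      by (rule sum_abs)
    also have "\<dots> = (\<Sum>\<tau>\<in>Pi\<^sub>E UNIV A'. K \<tau> * (\<Prod>k\<in>UNIV. \<bar>\<rho> (k, \<tau> k)\<bar>))"
      unfolding det_rows_mul using r0
      by (intro sum.cong) (simp_all add: K_def abs_mult abs_prod prod.distrib less_imp_le)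
    finally have "\<bar>det (slice_jacobian A l s \<rho> y)\<bar> \<le> (\<Sum>\<tau>\<in>Pi\<^sub>E UNIV A'. K \<tau> * (\<Prod>k\<in>UNIV. \<bar>\<rho> (k, \<tau> k)\<bar>))" .
    then have "\<bar>det (slice_jacobian A l s \<rho> y)\<bar> * std_normal_density_vec (slice_map A l s \<rho> y)
       \<le> (\<Sum>\<tau>\<in>Pi\<^sub>E UNIV A'. K \<tau> * (\<Prod>k\<in>UNIV. \<bar>\<rho> (k, \<tau> k)\<bar>)) * std_normal_density_vec (slice_map A l s \<rho> y)"
      by (rule mult_right_mono) (simp add: std_normal_density_vec_def prod_nonneg)
    also have "\<dots> = (\<Sum>\<tau>\<in>Pi\<^sub>E UNIV A'. K \<tau> * H \<tau> \<rho>)"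
      by (simp add: sum_distrib_right \<phi> H_def prod.distrib mult.assoc)
    finally show ?thesis .
  qed
  have Hm: "(\<lambda>\<rho>. ennreal (H \<tau> \<rho>)) \<in> borel_measurable ?P" if "\<tau> \<in> Pi\<^sub>E UNIV A'" for \<tau>
  proof -
    have m: "(\<lambda>\<rho>. \<rho> (k, \<alpha>)) \<in> borel_measurable ?P" if "\<alpha> \<in> A' k" for k \<alpha>
      using that by (intro measurable_coefficient) simp
    have "\<tau> k \<in> A' k" for k using that by auto
    note m\<tau> = m[OF this]
    have "(\<lambda>\<rho>. \<Sum>\<alpha>\<in>A' k. \<rho> (k, \<alpha>) * ?r k \<alpha>) \<in> borel_measurable ?P" for k
      by (intro borel_measurable_sum borel_measurable_times borel_measurable_const m)
    then have "(\<lambda>\<rho>. std_normal_density (\<Sum>\<alpha>\<in>A' k. \<rho> (k, \<alpha>) * ?r k \<alpha>)) \<in> borel_measurable ?P" for k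
      by (rule measurable_compose) simp
    then have "H \<tau> \<in> borel_measurable ?P" unfolding H_def
      by (intro borel_measurable_prod borel_measurable_times borel_measurable_abs m\<tau>)
    then show ?thesis by (rule measurable_compose) simp
  qed
  have "(\<integral>\<^sup>+\<rho>. ennreal (\<bar>det (slice_jacobian A l s \<rho> y)\<bar> * std_normal_density_vec (slice_map A l s \<rho> y)) \<partial>?P)
     \<le> (\<integral>\<^sup>+\<rho>. (\<Sum>\<tau>\<in>Pi\<^sub>E UNIV A'. ennreal (K \<tau>) * ennreal (H \<tau> \<rho>)) \<partial>?P)"
    using K0 H0 by (intro nn_integral_mono) (simp add: sum_ennreal bound ennreal_leI flip: ennreal_mult)
  also have "\<dots> = (\<Sum>\<tau>\<in>Pi\<^sub>E UNIV A'. ennreal (K \<tau>) * (\<integral>\<^sup>+\<rho>. ennreal (H \<tau> \<rho>) \<partial>?P))"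
    using Hm by (subst nn_integral_sum) (auto intro!: sum.cong nn_integral_cmult)
  also have "\<dots> \<le> (\<Sum>\<tau>\<in>Pi\<^sub>E UNIV A'. ennreal (K \<tau>) * ennreal (\<Prod>k\<in>UNIV. 1 / (pi * (1 + (?r k (\<tau> k))\<^sup>2))))"
  proof (intro sum_mono mult_left_mono)
    fix \<tau> assume "\<tau> \<in> Pi\<^sub>E UNIV A'"
    then have \<tau>: "\<tau> k \<in> A' k" for k by auto
    have "\<bar>?r k (\<tau> k)\<bar> \<le> 1" for k using r0[of k "\<tau> k"] r1[OF \<tau>] by simp
    then show "(\<integral>\<^sup>+\<rho>. ennreal (H \<tau> \<rho>) \<partial>?P) \<le> ennreal (\<Prod>k\<in>UNIV. 1 / (pi * (1 + (?r k (\<tau> k))\<^sup>2)))"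
      unfolding H_def by (intro nn_integral_std_normal_groups_le fin' \<tau>)
  qed simp
  also have "\<dots> = (\<Sum>\<tau>\<in>Pi\<^sub>E UNIV A'. ennreal (\<bar>det (\<chi> k. s k - \<tau> k)\<bar> *
          (\<Prod>k\<in>UNIV. exp_cauchy_density (l k (s k) - l k (\<tau> k) + (s k - \<tau> k) \<bullet> y))))"
  proof (intro sum.cong refl)
    fix \<tau>
    have "exp_cauchy_density (l k (s k) - l k (\<tau> k) + (s k - \<tau> k) \<bullet> y) = ?r k (\<tau> k) * (1 / (pi * (1 + (?r k (\<tau> k))\<^sup>2)))" for k
    proof -
      have "exp (- (l k (s k) - l k (\<tau> k) + (s k - \<tau> k) \<bullet> y)) = ?r k (\<tau> k)"
        unfolding relative_weight_def by (simp add: inner_diff_left algebra_simps)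
      then show ?thesis by (simp add: exp_cauchy_density_def)
    qed
    then have "(\<Prod>k\<in>UNIV. exp_cauchy_density (l k (s k) - l k (\<tau> k) + (s k - \<tau> k) \<bullet> y))
       = (\<Prod>k\<in>UNIV. ?r k (\<tau> k)) * (\<Prod>k\<in>UNIV. 1 / (pi * (1 + (?r k (\<tau> k))\<^sup>2)))"
      by (simp only: prod.distrib)
    then show "ennreal (K \<tau>) * ennreal (\<Prod>k\<in>UNIV. 1 / (pi * (1 + (?r k (\<tau> k))\<^sup>2)))
       = ennreal (\<bar>det (\<chi> k. s k - \<tau> k)\<bar> * (\<Prod>k\<in>UNIV. exp_cauchy_density (l k (s k) - l k (\<tau> k) + (s k - \<tau> k) \<bullet> y)))"
      using K0[of \<tau>] by (subst ennreal_mult[symmetric]) (simp_all add: K_def mult.assoc prod_nonneg)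
  qed
  finally show ?thesis .
qed

lemma measurable_slice_density:
  fixes A :: "'n::finite \<Rightarrow> (real^'n) set"
  assumes C: "closed C"
  shows "(\<lambda>(\<rho>, y). ennreal (\<bar>det (slice_jacobian A l s \<rho> y)\<bar> * std_normal_density_vec (slice_map A l s \<rho> y)) * indicator C y)
    \<in> borel_measurable (PiM (SIGMA k:UNIV. A k - {s k}) (\<lambda>_. std_normal) \<Otimes>\<^sub>M lborel)"
proof -
  let ?Q = "PiM (SIGMA k:UNIV. A k - {s k}) (\<lambda>_. std_normal) \<Otimes>\<^sub>M (lborel :: (real^'n) measure)"
  have \<rho>: "(\<lambda>x. fst x (k, \<alpha>)) \<in> borel_measurable ?Q" if "\<alpha> \<in> A k - {s k}" for k \<alpha>
    using that by (intro measurable_compose[OF measurable_fst measurable_coefficient]) simp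
  have w: "(\<lambda>x. relative_weight l s (snd x) k \<alpha>) \<in> borel_measurable ?Q" for k \<alpha>
    unfolding relative_weight_def by measurable
  have d: "(\<lambda>x. det (slice_jacobian A l s (fst x) (snd x))) \<in> borel_measurable ?Q"
    unfolding det_def slice_jacobian_def vec_lambda_beta sum_component vector_smult_component
    by (intro borel_measurable_sum borel_measurable_times borel_measurable_prod borel_measurable_const \<rho> w)
  have g: "(\<lambda>x. slice_map A l s (fst x) (snd x) $ k) \<in> borel_measurable ?Q" for k
    unfolding slice_map_def vec_lambda_beta
    by (intro borel_measurable_uminus borel_measurable_sum borel_measurable_times \<rho> w)
  have "(\<lambda>x. std_normal_density_vec (slice_map A l s (fst x) (snd x))) \<in> borel_measurable ?Q"
    unfolding std_normal_density_vec_def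
    by (intro borel_measurable_prod measurable_compose[OF g]) simp
  moreover have "(\<lambda>x. indicator C (snd x) :: ennreal) \<in> borel_measurable ?Q"
    using C by (intro measurable_compose[OF measurable_snd borel_measurable_indicator]) simp
  ultimately show ?thesis
    using d unfolding case_prod_beta by measurable
qed

text \<open>
  The selected coefficients are integrated first, by the area formula, and the order of integration over
  the other coefficients and \<open>y\<close> is then exchanged.
\<close>
lemma expected_zeros_in_cell_le:
  fixes A :: "'n::finite \<Rightarrow> (real^'n) set"
  assumes fin: "\<And>k. finite (A k)" and s: "\<And>k. s k \<in> A k"
  shows "(\<integral>\<^sup>+c. emeasure (count_space UNIV) (exp_regular_zeros A l (dominance_cell A l s) c)
            \<partial>PiM (SIGMA k:UNIV. A k) (\<lambda>_. std_normal))
      \<le> ennreal (1 / 4 ^ CARD('n) * (\<Prod>k\<in>UNIV. real (card (A k)) - 1))"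
proof -
  let ?C = "dominance_cell A l s"
  define A' where "A' k = A k - {s k}" for k
  define D where "D = range (\<lambda>k. (k, s k))"
  define R where "R = (SIGMA k:UNIV. A' k)"
  let ?I = "SIGMA k:UNIV. A k"
  let ?N = "\<lambda>c. emeasure (count_space UNIV) (exp_regular_zeros A l ?C c)"
  let ?PR = "PiM R (\<lambda>_. std_normal)"
  let ?J = "slice_jacobian A l s" and ?g = "slice_map A l s"
  have C: "closed ?C" by (rule closed_dominance_cell)
  have I: "?I = R \<union> D" using s by (auto simp: R_def D_def A'_def)
  have RD: "R \<inter> D = {}" by (auto simp: R_def D_def A'_def)
  have finR: "finite R" using fin by (simp add: R_def A'_def)
  have finD: "finite D" by (simp add: D_def)
  have Nm: "?N \<in> borel_measurable (PiM (R \<union> D) (\<lambda>_. std_normal))"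
    unfolding I[symmetric] by (rule measurable_exp_regular_zeros_count[OF C])
  have "(\<integral>\<^sup>+c. ?N c \<partial>PiM ?I (\<lambda>_. std_normal))
      = (\<integral>\<^sup>+\<rho>. (\<integral>\<^sup>+\<eta>. ?N (merge R D (\<rho>, \<eta>)) \<partial>PiM D (\<lambda>_. std_normal)) \<partial>?PR)"
    unfolding I by (rule std_normal_product.product_nn_integral_fold[OF RD finR finD Nm])
  also have "\<dots> = (\<integral>\<^sup>+\<rho>. (\<integral>\<^sup>+y. ennreal (\<bar>det (?J \<rho> y)\<bar> * std_normal_density_vec (?g \<rho> y)) * indicator ?C y \<partial>lborel) \<partial>?PR)"
  proof (rule nn_integral_cong)
    fix \<rho> assume \<rho>: "\<rho> \<in> space ?PR"
    have m: "(\<lambda>\<eta>. ?N (merge R D (\<rho>, \<eta>))) \<in> borel_measurable (PiM D (\<lambda>_. std_normal))"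
      using measurable_compose[OF measurable_compose[OF measurable_Pair1' [OF \<rho>] measurable_merge] Nm] .
    have "?N (merge R D (\<rho>, \<lambda>p\<in>D. z $ fst p)) = emeasure (count_space UNIV) {y \<in> ?C. ?g \<rho> y = z \<and> det (?J \<rho> y) \<noteq> 0}" for z :: "real^'n"
    proof -
      let ?c = "merge R D (\<rho>, \<lambda>p\<in>D. z $ fst p)"
      have c: "?c (k, \<alpha>) = \<rho> (k, \<alpha>)" if "\<alpha> \<in> A k - {s k}" for k \<alpha>
        using that by (simp add: merge_def R_def A'_def)
      have "?g ?c y = ?g \<rho> y" for y by (rule slice_map_cong[of A s ?c \<rho>], erule c)
      moreover have "?J ?c y = ?J \<rho> y" for y by (rule slice_jacobian_cong[of A s ?c \<rho>], erule c)
      moreover have "?c (k, s k) = z $ k" for k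
        by (auto simp: merge_def R_def A'_def D_def)
      ultimately show ?thesis by (simp add: regular_zeros_slice[OF fin s])
    qed
    then have "(\<integral>\<^sup>+\<eta>. ?N (merge R D (\<rho>, \<eta>)) \<partial>PiM D (\<lambda>_. std_normal))
       = (\<integral>\<^sup>+z. ennreal (std_normal_density_vec z) * emeasure (count_space UNIV) {y \<in> ?C. ?g \<rho> y = z \<and> det (?J \<rho> y) \<noteq> 0} \<partial>lborel)"
      using nn_integral_PiM_std_normal_graph[OF m[unfolded D_def]] by (simp add: std_normal_density_vec_def D_def)
    also have "\<dots> = (\<integral>\<^sup>+y. ennreal (\<bar>det (?J \<rho> y)\<bar> * std_normal_density_vec (?g \<rho> y)) * indicator ?C y \<partial>lborel)"
      using C by (intro area_formula has_derivative_slice_map continuous_slice_jacobian integrable_std_normal_density_vec)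
        (auto simp: std_normal_density_vec_def prod_nonneg)
    finally show "(\<integral>\<^sup>+\<eta>. ?N (merge R D (\<rho>, \<eta>)) \<partial>PiM D (\<lambda>_. std_normal)) = \<dots>" .
  qed
  also have "\<dots> = (\<integral>\<^sup>+y. (\<integral>\<^sup>+\<rho>. ennreal (\<bar>det (?J \<rho> y)\<bar> * std_normal_density_vec (?g \<rho> y)) * indicator ?C y \<partial>?PR) \<partial>lborel)"
  proof -
    interpret PR: sigma_finite_measure ?PR using finR by (rule std_normal_product.sigma_finite)
    interpret pair_sigma_finite ?PR "lborel :: (real^'n) measure" ..
    show ?thesis
      using measurable_slice_density[OF C, of A l s, folded A'_def, folded R_def] by (rule Fubini'[symmetric])
  qed
  also have "\<dots> \<le> (\<integral>\<^sup>+y. (\<Sum>\<tau>\<in>Pi\<^sub>E UNIV A'. ennreal (\<bar>det (\<chi> k. s k - \<tau> k)\<bar> *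
          (\<Prod>k\<in>UNIV. exp_cauchy_density (l k (s k) - l k (\<tau> k) + (s k - \<tau> k) \<bullet> y)))
          * indicator {y. \<forall>k. 0 \<le> l k (s k) - l k (\<tau> k) + (s k - \<tau> k) \<bullet> y} y) \<partial>lborel)"
  proof (rule nn_integral_mono)
    fix y
    show "(\<integral>\<^sup>+\<rho>. ennreal (\<bar>det (?J \<rho> y)\<bar> * std_normal_density_vec (?g \<rho> y)) * indicator ?C y \<partial>?PR)
      \<le> (\<Sum>\<tau>\<in>Pi\<^sub>E UNIV A'. ennreal (\<bar>det (\<chi> k. s k - \<tau> k)\<bar> *
          (\<Prod>k\<in>UNIV. exp_cauchy_density (l k (s k) - l k (\<tau> k) + (s k - \<tau> k) \<bullet> y)))
          * indicator {y. \<forall>k. 0 \<le> l k (s k) - l k (\<tau> k) + (s k - \<tau> k) \<bullet> y} y)"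
    proof (cases "y \<in> ?C")
      case True
      have "0 \<le> l k (s k) - l k (\<tau> k) + (s k - \<tau> k) \<bullet> y" if "\<tau> \<in> Pi\<^sub>E UNIV A'" for \<tau> k
      proof -
        have "\<tau> k \<in> A k" using that by (auto simp: A'_def)
        then have "l k (\<tau> k) + \<tau> k \<bullet> y \<le> l k (s k) + s k \<bullet> y" using True by (simp add: dominance_cell_def)
        then show ?thesis by (simp add: inner_diff_left)
      qed
      then have "(\<Sum>\<tau>\<in>Pi\<^sub>E UNIV A'. ennreal (\<bar>det (\<chi> k. s k - \<tau> k)\<bar> *
          (\<Prod>k\<in>UNIV. exp_cauchy_density (l k (s k) - l k (\<tau> k) + (s k - \<tau> k) \<bullet> y)))
          * indicator {y. \<forall>k. 0 \<le> l k (s k) - l k (\<tau> k) + (s k - \<tau> k) \<bullet> y} y)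
        = (\<Sum>\<tau>\<in>Pi\<^sub>E UNIV A'. ennreal (\<bar>det (\<chi> k. s k - \<tau> k)\<bar> *
          (\<Prod>k\<in>UNIV. exp_cauchy_density (l k (s k) - l k (\<tau> k) + (s k - \<tau> k) \<bullet> y))))"
        by (intro sum.cong) simp_all
      then show ?thesis
        using nn_integral_slice_density_le[OF fin True, folded A'_def] True by (simp add: R_def)
    qed simp
  qed
  also have "\<dots> = (\<Sum>\<tau>\<in>Pi\<^sub>E UNIV A'. \<integral>\<^sup>+y. ennreal (\<bar>det (\<chi> k. s k - \<tau> k)\<bar> *
          (\<Prod>k\<in>UNIV. exp_cauchy_density (l k (s k) - l k (\<tau> k) + (s k - \<tau> k) \<bullet> y)))
          * indicator {y. \<forall>k. 0 \<le> l k (s k) - l k (\<tau> k) + (s k - \<tau> k) \<bullet> y} y \<partial>lborel)"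
    by (rule nn_integral_sum) measurable
  also have "\<dots> \<le> (\<Sum>\<tau>\<in>Pi\<^sub>E UNIV A'. ennreal ((1 / 4) ^ CARD('n)))"
    by (intro sum_mono nn_integral_affine_exp_cauchy_le)
  also have "\<dots> = ennreal (1 / 4 ^ CARD('n) * (\<Prod>k\<in>UNIV. real (card (A k)) - 1))"
  proof -
    have "card (Pi\<^sub>E UNIV A') = (\<Prod>k\<in>UNIV. card (A' k))" by (simp add: card_PiE)
    moreover have "real (card (A' k)) = real (card (A k)) - 1" for k
      using fin[of k] s[of k] card_gt_0_iff[of "A k"] by (auto simp: A'_def of_nat_diff card_Diff_singleton)
    ultimately have "real (card (Pi\<^sub>E UNIV A')) = (\<Prod>k\<in>UNIV. real (card (A k)) - 1)" by simp
    then show ?thesis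
      by (simp add: ennreal_of_nat_eq_real_of_nat mult.commute power_one_over flip: ennreal_mult)
  qed
  finally show ?thesis .
qed

section \<open>Vertices of the Minkowski sum of upper envelopes\<close>

definition strict_selections :: "('n \<Rightarrow> 'a set) \<Rightarrow> ('n \<Rightarrow> 'a \<Rightarrow> real) \<Rightarrow> ('n \<Rightarrow> 'a::real_inner) set" where
  "strict_selections A l = {s. \<exists>y. \<forall>k. s k \<in> A k \<and> (\<forall>\<alpha>\<in>A k. \<alpha> \<noteq> s k \<longrightarrow> l k \<alpha> + \<alpha> \<bullet> y < l k (s k) + s k \<bullet> y)}"

lemma strict_selections_subset: "strict_selections A l \<subseteq> Pi\<^sub>E UNIV A"
  by (auto simp: strict_selections_def)

lemma in_upper_envelope: "\<alpha> \<in> A \<Longrightarrow> (l \<alpha>, \<alpha>) \<in> upper_envelope A l"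
  unfolding upper_envelope_def by (rule hull_inc) force

lemma convex_combination_less:
  fixes a b m u v :: real
  assumes "a \<le> m" "b \<le> m" "a < m \<or> b < m" "0 < u" "0 < v" "u + v = 1"
  shows "u * a + v * b < m"
proof -
  have "u * a \<le> u * m" "v * b \<le> v * m" using assms by (auto intro: mult_left_mono)
  moreover have "u * a < u * m \<or> v * b < v * m" using assms by auto
  moreover have "u * m + v * m = m" using assms(6) by (simp flip: distrib_right)
  ultimately show ?thesis by linarith
qed

text \<open>
  An open half-space together with one point on its boundary is convex, so it suffices to check the generators of
  the envelope.
\<close>
lemma upper_envelope_strict_max:
  fixes A :: "(real^'n) set"
  assumes \<alpha>: "\<alpha> \<in> A" and max: "\<And>\<beta>. \<beta> \<in> A \<Longrightarrow> \<beta> \<noteq> \<alpha> \<Longrightarrow> l \<beta> + \<beta> \<bullet> y < l \<alpha> + \<alpha> \<bullet> y"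
    and q: "q \<in> upper_envelope A l" "q \<noteq> (l \<alpha>, \<alpha>)"
  shows "(1, y) \<bullet> q < (1, y) \<bullet> (l \<alpha>, \<alpha>)"
proof -
  let ?p = "(l \<alpha>, \<alpha>)"
  let ?H = "{x. (1, y) \<bullet> x < (1, y) \<bullet> ?p} \<union> {?p}"
  have "convex ?H"
  proof (rule convexI)
    fix a b and u v :: real assume ab: "a \<in> ?H" "b \<in> ?H" and uv: "0 \<le> u" "0 \<le> v" "u + v = 1"
    show "u *\<^sub>R a + v *\<^sub>R b \<in> ?H"
    proof (cases "u = 0 \<or> v = 0 \<or> (a = ?p \<and> b = ?p)")
      case True
      have "u *\<^sub>R ?p + v *\<^sub>R ?p = ?p" by (metis scaleR_add_left scaleR_one uv(3))
      moreover have "u = 0 \<Longrightarrow> v = 1" "v = 0 \<Longrightarrow> u = 1" using uv(3) by simp_all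
      ultimately have "u *\<^sub>R a + v *\<^sub>R b = a \<or> u *\<^sub>R a + v *\<^sub>R b = b"
        using True by (elim disjE conjE) (simp_all only: scaleR_zero_left scaleR_one add_0_left add_0_right simp_thms)
      then show ?thesis using ab by (elim disjE) simp_all
    next
      case False
      then have uv': "0 < u" "0 < v" using uv by auto
      let ?m = "(1, y) \<bullet> ?p"
      have le: "(1, y) \<bullet> a \<le> ?m" "(1, y) \<bullet> b \<le> ?m" using ab by (auto intro: less_imp_le)
      have "(1, y) \<bullet> a < ?m \<or> (1, y) \<bullet> b < ?m" using ab False by blast
      then have "u * ((1, y) \<bullet> a) + v * ((1, y) \<bullet> b) < ?m"
        using le uv' uv(3) by (intro convex_combination_less)
      then show ?thesis by (simp only: inner_add_right inner_scaleR_right Un_iff mem_Collect_eq simp_thms)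
    qed
  qed
  moreover have "{(l \<alpha> - s, \<alpha>) |\<alpha> s. \<alpha> \<in> A \<and> 0 \<le> s} \<subseteq> ?H"
  proof
    fix x assume "x \<in> {(l \<alpha> - s, \<alpha>) |\<alpha> s. \<alpha> \<in> A \<and> 0 \<le> s}"
    then obtain \<beta> s where \<beta>: "\<beta> \<in> A" "0 \<le> s" and x: "x = (l \<beta> - s, \<beta>)" by blast
    show "x \<in> ?H"
    proof (cases "\<beta> = \<alpha> \<and> s = 0")
      case False
      then have "(l \<beta> - s) + \<beta> \<bullet> y < l \<alpha> + \<alpha> \<bullet> y"
        using max[OF \<beta>(1)] \<beta>(2) by (cases "\<beta> = \<alpha>") auto
      then show ?thesis by (simp add: x inner_commute)
    qed (simp add: x)
  qed
  ultimately have "upper_envelope A l \<subseteq> ?H"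
    unfolding upper_envelope_def by (rule hull_minimal[rotated])
  then show ?thesis using q by blast
qed

lemma sum_upper_envelope_strict_max:
  fixes A :: "'n::finite \<Rightarrow> (real^'n) set"
  assumes s: "\<And>k. s k \<in> A k" and max: "\<And>k \<beta>. \<beta> \<in> A k \<Longrightarrow> \<beta> \<noteq> s k \<Longrightarrow> l k \<beta> + \<beta> \<bullet> y < l k (s k) + s k \<bullet> y"
    and q: "\<And>k. q k \<in> upper_envelope (A k) (l k)" "q k \<noteq> (l k (s k), s k)"
  shows "(1, y) \<bullet> (\<Sum>k\<in>UNIV. q k) < (1, y) \<bullet> (\<Sum>k\<in>UNIV. (l k (s k), s k))"
proof -
  have lt: "(1, y) \<bullet> q k < (1, y) \<bullet> (l k (s k), s k)" if "q k \<noteq> (l k (s k), s k)" for k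
    by (rule upper_envelope_strict_max[OF s max q(1) that])
  have "(1, y) \<bullet> q k \<le> (1, y) \<bullet> (l k (s k), s k)" for k
    by (cases "q k = (l k (s k), s k)") (simp, metis lt less_imp_le)
  then have "(\<Sum>k\<in>UNIV. (1, y) \<bullet> q k) < (\<Sum>k\<in>UNIV. (1, y) \<bullet> (l k (s k), s k))"
    using lt[OF q(2)] by (intro sum_strict_mono_ex1) auto
  then show ?thesis by (simp only: inner_sum_right)
qed

lemma sum_upper_envelope_alt:
  "(\<Sum>k\<in>UNIV. upper_envelope (A k) (l k)) = {\<Sum>k\<in>UNIV. q k |q. \<forall>k. q k \<in> upper_envelope (A k) (l k)}"
  for A :: "'n::finite \<Rightarrow> (real^'n) set"
  by (simp add: set_sum_alt)

text \<open>
  The functional \<open>(1, y)\<close> that witnesses the strict selection attains its maximum over the Minkowski sum at this point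
  only, so the point cannot lie inside a segment of the sum.
\<close>
lemma strict_selection_extreme_point:
  fixes A :: "'n::finite \<Rightarrow> (real^'n) set"
  assumes "s \<in> strict_selections A l"
  shows "(\<Sum>k\<in>UNIV. (l k (s k), s k)) extreme_point_of (\<Sum>k\<in>UNIV. upper_envelope (A k) (l k))"
proof -
  obtain y where s: "\<And>k. s k \<in> A k"
    and max: "\<And>k \<beta>. \<beta> \<in> A k \<Longrightarrow> \<beta> \<noteq> s k \<Longrightarrow> l k \<beta> + \<beta> \<bullet> y < l k (s k) + s k \<bullet> y"
    using assms unfolding strict_selections_def by blast
  let ?P = "\<Sum>k\<in>UNIV. upper_envelope (A k) (l k)" and ?p = "\<Sum>k\<in>UNIV. (l k (s k), s k)"
  have less: "(1, y) \<bullet> q < (1, y) \<bullet> ?p" if q: "q \<in> ?P" "q \<noteq> ?p" for q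
  proof -
    from q(1) obtain r where "q = (\<Sum>k\<in>UNIV. r k)" and "\<forall>k. r k \<in> upper_envelope (A k) (l k)"
      unfolding sum_upper_envelope_alt by (elim CollectE exE conjE)
    then have r: "q = (\<Sum>k\<in>UNIV. r k)" "\<And>k. r k \<in> upper_envelope (A k) (l k)" by auto
    have "\<exists>k. r k \<noteq> (l k (s k), s k)"
    proof (rule ccontr)
      assume "\<not> (\<exists>k. r k \<noteq> (l k (s k), s k))"
      then have "r = (\<lambda>k. (l k (s k), s k))" by blast
      then show False using q(2) r(1) by simp
    qed
    then obtain k where k: "r k \<noteq> (l k (s k), s k)" ..
    show ?thesis unfolding r(1)
    proof (rule sum_upper_envelope_strict_max)
      show "r k \<noteq> (l k (s k), s k)" by (rule k)
    qed (fact s max r(2))+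
  qed
  have "?p \<in> ?P"
    unfolding sum_upper_envelope_alt
    by (intro CollectI exI[of _ "\<lambda>k. (l k (s k), s k)"] conjI allI refl in_upper_envelope s)
  moreover have "?p \<notin> open_segment a b" if ab: "a \<in> ?P" "b \<in> ?P" for a b
  proof
    assume "?p \<in> open_segment a b"
    then obtain u where u: "a \<noteq> b" "0 < u" "u < 1" "?p = (1 - u) *\<^sub>R a + u *\<^sub>R b" by (auto simp: in_segment)
    let ?m = "(1, y) \<bullet> ?p"
    have m: "?m = (1 - u) * ((1, y) \<bullet> a) + u * ((1, y) \<bullet> b)"
      by (subst u(4)) (simp only: inner_add_right inner_scaleR_right)
    have le: "(1, y) \<bullet> q \<le> ?m" if "q \<in> ?P" for q
    proof (cases "q = ?p")
      case False
      from less[OF that this] show ?thesis by (rule less_imp_le)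
    qed (simp only: order_refl)
    have "a \<noteq> ?p \<or> b \<noteq> ?p" using u(1) by blast
    then have "(1, y) \<bullet> a < ?m \<or> (1, y) \<bullet> b < ?m" using less[OF ab(1)] less[OF ab(2)] by blast
    then have "(1 - u) * ((1, y) \<bullet> a) + u * ((1, y) \<bullet> b) < ?m"
      using le[OF ab(1)] le[OF ab(2)] u(2,3) by (intro convex_combination_less) (simp_all only: diff_gt_0_iff_gt diff_add_cancel)
    then show False unfolding m[symmetric] by (rule less_irrefl[THEN notE, rotated])
  qed
  ultimately show ?thesis by (simp add: extreme_point_of_def)
qed

text \<open>
  The vertex of \<open>s'\<close> is a sum of points of the envelopes; unless \<open>s' = s\<close>, the functional that selects \<open>s\<close> is strictly
  smaller on it than on the vertex of \<open>s\<close>.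
\<close>
lemma strict_selection_vertex_inj:
  fixes A :: "'n::finite \<Rightarrow> (real^'n) set"
  shows "inj_on (\<lambda>s. \<Sum>k\<in>UNIV. (l k (s k), s k)) (strict_selections A l)"
proof (rule inj_onI, rule ccontr)
  fix s s' assume s: "s \<in> strict_selections A l" and s': "s' \<in> strict_selections A l"
    and eq: "(\<Sum>k\<in>UNIV. (l k (s k), s k)) = (\<Sum>k\<in>UNIV. (l k (s' k), s' k))" and ne: "s \<noteq> s'"
  obtain k where k: "s' k \<noteq> s k" using ne by (metis ext)
  obtain y where y: "\<And>k. s k \<in> A k"
      "\<And>k \<beta>. \<beta> \<in> A k \<Longrightarrow> \<beta> \<noteq> s k \<Longrightarrow> l k \<beta> + \<beta> \<bullet> y < l k (s k) + s k \<bullet> y"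
    using s unfolding strict_selections_def by blast
  have "s' k \<in> A k" for k using s' strict_selections_subset by blast
  then have "(1, y) \<bullet> (\<Sum>k\<in>UNIV. (l k (s' k), s' k)) < (1, y) \<bullet> (\<Sum>k\<in>UNIV. (l k (s k), s k))"
    using k by (intro sum_upper_envelope_strict_max[where k = k] y in_upper_envelope) (auto intro: y(1))
  then show False using eq by simp
qed

lemma extreme_point_of_upper_envelope:
  fixes A :: "(real^'n) set"
  assumes "p extreme_point_of (upper_envelope A l)"
  shows "p \<in> (\<lambda>\<alpha>. (l \<alpha>, \<alpha>)) ` A"
proof -
  from assms have "p \<in> {(l \<alpha> - s, \<alpha>) |\<alpha> s. \<alpha> \<in> A \<and> 0 \<le> s}"
    unfolding upper_envelope_def by (rule extreme_point_of_convex_hull)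
  then obtain \<alpha> s where \<alpha>: "\<alpha> \<in> A" "0 \<le> s" "p = (l \<alpha> - s, \<alpha>)" by blast
  have "s = 0"
  proof (rule ccontr)
    assume "s \<noteq> 0"
    let ?a = "(l \<alpha>, \<alpha>)" and ?b = "(l \<alpha> - 2 * s, \<alpha>)"
    have "?a \<in> upper_envelope A l" "?b \<in> upper_envelope A l"
      unfolding upper_envelope_def using \<alpha>(1,2) by (auto intro!: hull_inc intro: exI[of _ 0] exI[of _ "2 * s"])
    moreover have "p \<in> open_segment ?a ?b"
      unfolding in_segment using \<open>s \<noteq> 0\<close> by (auto simp: \<alpha>(3) field_simps intro!: exI[of _ "1 / 2"] simp flip: scaleR_add_left)
    ultimately show False using assms by (auto simp: extreme_point_of_def)
  qed
  then show ?thesis using \<alpha> by simp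
qed

text \<open>
  An extreme point of a Minkowski sum is a sum of extreme points of the summands, and those of an envelope are
  lifted exponents. Finiteness matters because \<open>num_vertices\<close> would be \<open>0\<close> for infinitely many extreme points.
\<close>
lemma finite_extreme_points_sum_upper_envelope:
  fixes A :: "'n::finite \<Rightarrow> (real^'n) set"
  assumes fin: "\<And>k. finite (A k)"
  shows "finite {p. p extreme_point_of (\<Sum>k\<in>UNIV. upper_envelope (A k) (l k))}"
proof (rule finite_subset)
  let ?P = "\<Sum>k\<in>UNIV. upper_envelope (A k) (l k)"
  show "finite ((\<lambda>s. \<Sum>k\<in>UNIV. (l k (s k), s k)) ` Pi\<^sub>E UNIV A)"
    using fin by (intro finite_imageI finite_PiE) auto
  show "{p. p extreme_point_of ?P} \<subseteq> (\<lambda>s. \<Sum>k\<in>UNIV. (l k (s k), s k)) ` Pi\<^sub>E UNIV A"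
  proof safe
    fix p assume p: "p extreme_point_of ?P"
    then obtain q where q: "p = (\<Sum>k\<in>UNIV. q k)" "\<And>k. q k \<in> upper_envelope (A k) (l k)"
      unfolding extreme_point_of_def sum_upper_envelope_alt by blast
    have "q k extreme_point_of (upper_envelope (A k) (l k))" for k
      unfolding extreme_point_of_def
    proof (intro conjI ballI notI q(2))
      fix a b assume ab: "a \<in> upper_envelope (A k) (l k)" "b \<in> upper_envelope (A k) (l k)" and "q k \<in> open_segment a b"
      then obtain u where u: "a \<noteq> b" "0 < u" "u < 1" "q k = (1 - u) *\<^sub>R a + u *\<^sub>R b" by (auto simp: in_segment)
      define r where "r = (\<Sum>j\<in>UNIV - {k}. q j)"
      have mem: "r + x \<in> ?P" if "x \<in> upper_envelope (A k) (l k)" for x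
      proof -
        have "r + x = (\<Sum>j\<in>UNIV. (q(k := x)) j)"
          unfolding r_def by (subst (2) sum.remove[of _ k]) (auto intro: sum.cong)
        moreover have "(q(k := x)) j \<in> upper_envelope (A j) (l j)" for j using that q(2) by simp
        ultimately show ?thesis unfolding sum_upper_envelope_alt by blast
      qed
      have "p = r + q k" unfolding q(1) r_def by (subst sum.remove[of _ k]) (auto simp: add.commute)
      then have "p = (1 - u) *\<^sub>R (r + a) + u *\<^sub>R (r + b)" by (simp add: u(4) algebra_simps)
      then have "p \<in> open_segment (r + a) (r + b)" using u by (auto simp: in_segment)
      then show False using p mem[OF ab(1)] mem[OF ab(2)] by (simp add: extreme_point_of_def)
    qed
    then have "q k \<in> (\<lambda>\<alpha>. (l k \<alpha>, \<alpha>)) ` A k" for k by (rule extreme_point_of_upper_envelope)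
    then obtain s where "\<And>k. s k \<in> A k \<and> q k = (l k (s k), s k)"
      unfolding image_iff by metis
    then show "p \<in> (\<lambda>s. \<Sum>k\<in>UNIV. (l k (s k), s k)) ` Pi\<^sub>E UNIV A"
      unfolding q(1) by (intro image_eqI[of _ _ s]) auto
  qed
qed

lemma card_strict_selections_le:
  fixes A :: "'n::finite \<Rightarrow> (real^'n) set"
  assumes "\<And>k. finite (A k)"
  shows "card (strict_selections A l) \<le> num_vertices (\<Sum>k\<in>UNIV. upper_envelope (A k) (l k))"
  unfolding num_vertices_def
  using strict_selection_extreme_point
  by (intro card_inj_on_le[OF strict_selection_vertex_inj] finite_extreme_points_sum_upper_envelope assms) auto

lemma finite_strict_selections:
  fixes A :: "'n::finite \<Rightarrow> 'a::real_inner set"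
  assumes "\<And>k. finite (A k)"
  shows "finite (strict_selections A l)"
  using finite_subset[OF strict_selections_subset finite_PiE[OF finite assms]] .

section \<open>Expected number of positive zeros\<close>

text \<open>
  Two distinct exponents tie only on a hyperplane, so the points without any tie are dense; they lie in the
  finite, hence closed, union of the cells of strict selections.
\<close>
lemma UN_dominance_cells:
  fixes A :: "'n::finite \<Rightarrow> (real^'n) set"
  assumes fin: "\<And>k. finite (A k)" and ne: "\<And>k. A k \<noteq> {}"
  shows "(\<Union>s\<in>strict_selections A l. dominance_cell A l s) = UNIV"
proof -
  let ?U = "\<Union>s\<in>strict_selections A l. dominance_cell A l s"
  define T where "T = (\<Union>k. \<Union>\<alpha>\<in>A k. \<Union>\<beta>\<in>A k - {\<alpha>}. {y. (\<alpha> - \<beta>) \<bullet> y = l k \<beta> - l k \<alpha>})"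
  have "negligible T"
    unfolding T_def using fin by (intro negligible_Union finite_imageI) (auto intro!: negligible_Union negligible_hyperplane)
  have "- T \<subseteq> ?U"
  proof
    fix y assume y: "y \<in> - T"
    have "\<exists>\<alpha>\<in>A k. \<forall>\<beta>\<in>A k. l k \<beta> + \<beta> \<bullet> y \<le> l k \<alpha> + \<alpha> \<bullet> y" for k
    proof -
      let ?f = "\<lambda>\<alpha>. l k \<alpha> + \<alpha> \<bullet> y"
      have "Max (?f ` A k) \<in> ?f ` A k" using fin ne by (intro Max_in) auto
      then obtain \<alpha> where "\<alpha> \<in> A k" "?f \<alpha> = Max (?f ` A k)" by auto
      then show ?thesis using fin by (intro bexI[of _ \<alpha>]) auto
    qed
    then obtain s where s: "\<And>k. s k \<in> A k" "\<And>k \<beta>. \<beta> \<in> A k \<Longrightarrow> l k \<beta> + \<beta> \<bullet> y \<le> l k (s k) + s k \<bullet> y" by metis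
    have "l k \<beta> + \<beta> \<bullet> y \<noteq> l k (s k) + s k \<bullet> y" if "\<beta> \<in> A k" "\<beta> \<noteq> s k" for k \<beta>
    proof
      assume "l k \<beta> + \<beta> \<bullet> y = l k (s k) + s k \<bullet> y"
      then have "(s k - \<beta>) \<bullet> y = l k \<beta> - l k (s k)" by (simp add: inner_diff_left)
      then have "y \<in> T" unfolding T_def using that s(1) by blast
      then show False using y by simp
    qed
    then have "s \<in> strict_selections A l"
      unfolding strict_selections_def using s by (auto simp: order_less_le intro!: exI[of _ y])
    moreover have "y \<in> dominance_cell A l s" using s(2) by (simp add: dominance_cell_def)
    ultimately show "y \<in> ?U" by blast
  qed
  moreover have "closed ?U"
    by (intro closed_UN ballI finite_strict_selections fin closed_dominance_cell)
  moreover have "closure (- T) = UNIV"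
    using open_not_negligible[OF open_interior, of T] negligible_subset[OF \<open>negligible T\<close> interior_subset]
    by (auto simp: closure_complement)
  ultimately have "UNIV \<subseteq> ?U" using closure_minimal[of "- T" ?U] by simp
  then show ?thesis by blast
qed

lemma emeasure_count_space_image_le:
  "emeasure (count_space UNIV) (f ` S) \<le> emeasure (count_space UNIV) S"
proof (cases "finite S")
  case True
  then show ?thesis using card_image_le[OF True, of f] by simp
qed simp

lemma emeasure_count_space_UN_le:
  assumes "finite I"
  shows "emeasure (count_space UNIV) (\<Union>i\<in>I. S i) \<le> (\<Sum>i\<in>I. emeasure (count_space UNIV) (S i))"
  using assms by (intro emeasure_subadditive_finite) auto

text \<open>
  On the positive orthant a monomial is \<open>exp (\<Sum>i. \<alpha>\<^sub>i ln x\<^sub>i)\<close>.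
\<close>
lemma has_derivative_monomial:
  fixes x :: "real^'n::finite"
  assumes x: "x \<in> pos_orthant"
  shows "(monomial \<alpha> has_derivative (\<lambda>h. monomial \<alpha> x * (\<Sum>i\<in>UNIV. \<alpha> $ i * h $ i / x $ i))) (at x)"
proof -
  have eq: "monomial \<alpha> z = exp (\<Sum>i\<in>UNIV. \<alpha> $ i * ln (z $ i))" if "z \<in> pos_orthant" for z :: "real^'n"
    using that by (simp add: monomial_def pos_orthant_def powr_def exp_sum order_less_imp_not_eq2)
  have pos: "x $ i > 0" for i using x by (simp add: pos_orthant_def)
  have opn: "open (pos_orthant :: (real^'n) set)"
  proof -
    have "(pos_orthant :: (real^'n) set) = (\<Inter>i. {z. 0 < z $ i})" by (auto simp: pos_orthant_def)
    moreover have "open (\<Inter>i. {z :: real^'n. 0 < z $ i})"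
      by (intro open_INT finite ballI open_Collect_less continuous_intros)
    ultimately show ?thesis by simp
  qed
  have deriv: "((\<lambda>z. exp (\<Sum>i\<in>UNIV. \<alpha> $ i * ln (z $ i))) has_derivative
      (\<lambda>h. exp (\<Sum>i\<in>UNIV. \<alpha> $ i * ln (x $ i)) * (\<Sum>i\<in>UNIV. \<alpha> $ i * h $ i / x $ i))) (at x)"
  proof -
    have c: "((\<lambda>z :: real^'n. z $ i) has_derivative (\<lambda>h. h $ i)) (at x)" for i
      by (intro bounded_linear_imp_has_derivative bounded_linear_vec_nth)
    have "((\<lambda>z. \<alpha> $ i * ln (z $ i)) has_derivative (\<lambda>h. \<alpha> $ i * h $ i / x $ i)) (at x)" for i
      by (rule has_derivative_eq_rhs[OF has_derivative_mult_right[OF has_derivative_ln[OF pos c]]])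
        (simp add: divide_inverse mult_ac)
    from has_derivative_exp[OF has_derivative_sum[OF this]]
    show ?thesis by (simp add: mult.commute)
  qed
  show ?thesis
    unfolding eq[OF x]
    by (rule has_derivative_transform_within_open[OF deriv opn x]) (simp add: eq)
qed

lemma jacobian_fewnomial_system:
  fixes A :: "'n::finite \<Rightarrow> (real^'n) set"
  assumes x: "x \<in> pos_orthant"
  shows "jacobian (fewnomial_system A c) (at x)
    = (\<chi> k i. (\<Sum>\<alpha>\<in>A k. c k \<alpha> * monomial \<alpha> x * \<alpha> $ i) * inverse (x $ i))"
proof -
  let ?J = "\<chi> k i. (\<Sum>\<alpha>\<in>A k. c k \<alpha> * monomial \<alpha> x * \<alpha> $ i) * inverse (x $ i)"
  have comp: "((\<lambda>y. fewnomial_system A c y $ k) has_derivative (\<lambda>h. (?J *v h) $ k)) (at x)" for k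
  proof -
    have "((\<lambda>y. fewnomial_system A c y $ k) has_derivative
        (\<lambda>h. \<Sum>\<alpha>\<in>A k. c k \<alpha> * (monomial \<alpha> x * (\<Sum>i\<in>UNIV. \<alpha> $ i * h $ i / x $ i)))) (at x)"
      unfolding fewnomial_system_def fewnomial_def vec_lambda_beta
      by (intro has_derivative_sum has_derivative_mult_right has_derivative_monomial x)
    moreover have "(\<Sum>\<alpha>\<in>A k. c k \<alpha> * (monomial \<alpha> x * (\<Sum>i\<in>UNIV. \<alpha> $ i * h $ i / x $ i))) = (?J *v h) $ k" for h
    proof -
      have "(\<Sum>\<alpha>\<in>A k. c k \<alpha> * (monomial \<alpha> x * (\<Sum>i\<in>UNIV. \<alpha> $ i * h $ i / x $ i)))
          = (\<Sum>\<alpha>\<in>A k. \<Sum>i\<in>UNIV. c k \<alpha> * monomial \<alpha> x * \<alpha> $ i * inverse (x $ i) * h $ i)"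
        by (simp add: sum_distrib_left divide_inverse mult_ac)
      also have "\<dots> = (\<Sum>i\<in>UNIV. \<Sum>\<alpha>\<in>A k. c k \<alpha> * monomial \<alpha> x * \<alpha> $ i * inverse (x $ i) * h $ i)"
        by (rule sum.swap)
      also have "\<dots> = (?J *v h) $ k"
        by (simp add: matrix_vector_mult_def sum_distrib_right)
      finally show ?thesis .
    qed
    ultimately show ?thesis by simp
  qed
  have "(fewnomial_system A c has_derivative (*v) ?J) (at x)"
    unfolding has_derivative_componentwise_within[of "fewnomial_system A c"]
    using comp by (auto simp: Basis_vec_def inner_axis)
  then have "frechet_derivative (fewnomial_system A c) (at x) = (*v) ?J"
    by (rule frechet_derivative_at[symmetric])
  then show ?thesis by (simp only: jacobian_def matrix_of_matrix_vector_mul)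
qed

text \<open>
  Under \<open>x = exp y\<close> column \<open>i\<close> of the Jacobian is multiplied by the positive number \<open>x\<^sub>i\<close>, which preserves regularity.
\<close>
lemma regular_zeros_log_image:
  fixes A :: "'n::finite \<Rightarrow> (real^'n) set"
  assumes c: "\<And>k \<alpha>. \<alpha> \<in> A k \<Longrightarrow> c k \<alpha> = d (k, \<alpha>) * exp (l k \<alpha>)"
  shows "regular_zeros (fewnomial_system A c) pos_orthant \<subseteq> (\<lambda>y. \<chi> i. exp (y $ i)) ` exp_regular_zeros A l UNIV d"
proof
  fix x assume "x \<in> regular_zeros (fewnomial_system A c) pos_orthant"
  then have x: "x \<in> pos_orthant" "fewnomial_system A c x = 0" "det (jacobian (fewnomial_system A c) (at x)) \<noteq> 0"
    by (auto simp: regular_zeros_def)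
  define y where "y = (\<chi> i. ln (x $ i))"
  have pos: "x $ i > 0" for i using x by (simp add: pos_orthant_def)
  have xy: "x = (\<chi> i. exp (y $ i))" using pos by (simp add: y_def vec_eq_iff)
  have mon: "monomial \<alpha> x = exp (\<alpha> \<bullet> y)" for \<alpha>
    by (simp add: xy monomial_def powr_def inner_vec_def exp_sum)
  have summand: "c k \<alpha> * monomial \<alpha> x = d (k, \<alpha>) * exp (l k \<alpha> + \<alpha> \<bullet> y)" if "\<alpha> \<in> A k" for k \<alpha>
    using that by (simp add: c mon exp_add)
  have "exp_system A l d y = fewnomial_system A c x"
    by (simp add: exp_system_def fewnomial_system_def fewnomial_def vec_eq_iff summand cong: sum.cong)
  moreover have "jacobian (fewnomial_system A c) (at x) = (\<chi> k i. exp_jacobian A l d y $ k $ i * inverse (x $ i))"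
    unfolding jacobian_fewnomial_system[OF x(1)] by (simp add: exp_jacobian_def summand cong: sum.cong)
  then have "det (jacobian (fewnomial_system A c) (at x)) = (\<Prod>i\<in>UNIV. inverse (x $ i)) * det (exp_jacobian A l d y)"
  proof -
    assume J: "jacobian (fewnomial_system A c) (at x) = (\<chi> k i. exp_jacobian A l d y $ k $ i * inverse (x $ i))"
    have "transpose (jacobian (fewnomial_system A c) (at x)) = (\<chi> i. inverse (x $ i) *s (transpose (exp_jacobian A l d y) $ i))"
      unfolding J by (simp add: transpose_def vec_eq_iff mult.commute)
    then have "det (transpose (jacobian (fewnomial_system A c) (at x)))
        = (\<Prod>i\<in>UNIV. inverse (x $ i)) * det (\<chi> i. transpose (exp_jacobian A l d y) $ i)"
      by (simp only: det_rows_mul)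
    then show ?thesis by (simp add: det_transpose)
  qed
  then have "det (exp_jacobian A l d y) \<noteq> 0" using x(3) by auto
  ultimately have "y \<in> exp_regular_zeros A l UNIV d" using x(2) by (simp add: exp_regular_zeros_def)
  then show "x \<in> (\<lambda>y. \<chi> i. exp (y $ i)) ` exp_regular_zeros A l UNIV d" using xy by blast
qed

theorem theorem1p9:
  fixes A :: "'n::finite \<Rightarrow> (real ^ 'n) set"
    and t :: "'n \<Rightarrow> nat"
    and M :: "'w measure"
    and F :: "'n \<Rightarrow> real ^ 'n \<Rightarrow> 'w \<Rightarrow> real"
    and v :: "'n \<Rightarrow> real ^ 'n \<Rightarrow> real"
    and l :: "'n \<Rightarrow> real ^ 'n \<Rightarrow> real"
  assumes "prob_space M"
    and "\<And>k. finite (A k)"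
    and "\<And>k. A k \<noteq> {}"
    and "\<And>k. card (A k) = t k"
    and "\<And>k \<alpha>. \<alpha> \<in> A k \<Longrightarrow> 0 < v k \<alpha>"
    and "\<And>k \<alpha>. \<alpha> \<in> A k \<Longrightarrow> distributed M lborel (F k \<alpha>) (normal_density 0 (sqrt (v k \<alpha>)))"
    and "prob_space.indep_vars M (\<lambda>_. borel) (\<lambda>(k, \<alpha>). F k \<alpha>) (SIGMA k:UNIV. A k)"
    and "\<And>k \<alpha>. \<alpha> \<in> A k \<Longrightarrow> l k \<alpha> = 1 / 2 * ln (v k \<alpha>)"
  shows "(\<integral>\<^sup>+\<omega>. emeasure (count_space UNIV)
            (regular_zeros (fewnomial_system A (\<lambda>k \<alpha>. F k \<alpha> \<omega>)) pos_orthant) \<partial>M)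
       \<le> ennreal (1 / 4 ^ CARD('n)
            * real (num_vertices (\<Sum>k\<in>UNIV. upper_envelope (A k) (l k)))
            * (\<Prod>k\<in>UNIV. (real (t k) - 1)))"
proof -
  interpret prob_space M by fact
  note fin = assms(2) and ne = assms(3)
  let ?I = "SIGMA k:UNIV. A k"
  let ?S = "strict_selections A l"
  let ?P = "PiM ?I (\<lambda>_. std_normal)"
  \<comment> \<open>Division by the standard deviation \<open>sqrt (v k \<alpha>) = exp (l k \<alpha>)\<close> gives i.i.d. standard normal coefficients.\<close>
  define X where "X p \<omega> = F (fst p) (snd p) \<omega> / sqrt (v (fst p) (snd p))" for p \<omega>
  define d where "d \<omega> = (\<lambda>p\<in>?I. X p \<omega>)" for \<omega>
  have sd: "exp (l k \<alpha>) = sqrt (v k \<alpha>)" if "\<alpha> \<in> A k" for k \<alpha>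
    using assms(5,8)[OF that] by (simp add: ln_sqrt[symmetric])
  have X: "distributed M lborel (X p) std_normal_density" if mem: "p \<in> ?I" for p
  proof -
    obtain k \<alpha> where p: "p = (k, \<alpha>)" "\<alpha> \<in> A k" using mem by auto
    then show ?thesis
      using normal_standard_normal_convert[of "sqrt (v k \<alpha>)" "F k \<alpha>" 0] assms(5,6)[OF p(2)]
      by (simp add: X_def[abs_def])
  qed
  have "indep_vars (\<lambda>_. borel) (\<lambda>p \<omega>. (\<lambda>x. x / sqrt (v (fst p) (snd p))) ((\<lambda>(k, \<alpha>). F k \<alpha>) p \<omega>)) ?I"
    by (rule indep_vars_compose2[OF assms(7)]) simp
  then have ind: "indep_vars (\<lambda>_. borel) X ?I"
    by (simp add: X_def[abs_def] case_prod_beta)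
  have rv: "X p \<in> borel_measurable M" if "p \<in> ?I" for p
    using distributed_measurable[OF X[OF that]] by simp
  have ne_I: "?I \<noteq> {}" using ne by auto
  have law: "distr M ?P d = ?P"
  proof -
    have "distr M (PiM ?I (\<lambda>_. borel)) (\<lambda>\<omega>. \<lambda>p\<in>?I. X p \<omega>) = PiM ?I (\<lambda>p. distr M borel (X p))"
      using indep_vars_iff_distr_eq_PiM'[OF ne_I, of X "\<lambda>_. borel", OF rv] ind by (rule iffD1)
    moreover have "PiM ?I (\<lambda>p. distr M borel (X p)) = ?P"
    proof (rule PiM_cong[OF refl])
      fix p assume "p \<in> ?I"
      have "distr M borel (X p) = distr M lborel (X p)" by (rule distr_cong) simp_all
      also have "\<dots> = std_normal" using distributed_distr_eq_density[OF X[OF \<open>p \<in> ?I\<close>]] .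
      finally show "distr M borel (X p) = std_normal" .
    qed
    moreover have "distr M (PiM ?I (\<lambda>_. borel)) (\<lambda>\<omega>. \<lambda>p\<in>?I. X p \<omega>) = distr M ?P d"
      unfolding d_def[abs_def] by (intro distr_cong sets_PiM_cong refl) simp_all
    ultimately show ?thesis by simp
  qed
  have dm: "d \<in> M \<rightarrow>\<^sub>M ?P"
    unfolding d_def[abs_def] using rv by (intro measurable_restrict) simp
  have count_le: "emeasure (count_space UNIV) (regular_zeros (fewnomial_system A (\<lambda>k \<alpha>. F k \<alpha> \<omega>)) pos_orthant)
      \<le> (\<Sum>s\<in>?S. emeasure (count_space UNIV) (exp_regular_zeros A l (dominance_cell A l s) (d \<omega>)))" for \<omega>
  proof -
    have F: "F k \<alpha> \<omega> = d \<omega> (k, \<alpha>) * exp (l k \<alpha>)" if "\<alpha> \<in> A k" for k \<alpha>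
      using that assms(5)[OF that] by (simp add: d_def X_def sd)
    have "emeasure (count_space UNIV) (regular_zeros (fewnomial_system A (\<lambda>k \<alpha>. F k \<alpha> \<omega>)) pos_orthant)
       \<le> emeasure (count_space UNIV) ((\<lambda>y :: real^'n. \<chi> i. exp (y $ i)) ` exp_regular_zeros A l UNIV (d \<omega>))"
      by (intro emeasure_mono regular_zeros_log_image F) auto
    also have "\<dots> \<le> emeasure (count_space UNIV) (exp_regular_zeros A l UNIV (d \<omega>))"
      by (rule emeasure_count_space_image_le)
    also have "exp_regular_zeros A l UNIV (d \<omega>) = (\<Union>s\<in>?S. exp_regular_zeros A l (dominance_cell A l s) (d \<omega>))"
      using UN_dominance_cells[of A l, OF fin ne] by (auto simp: exp_regular_zeros_def)
    also have "emeasure (count_space UNIV) \<dots>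
        \<le> (\<Sum>s\<in>?S. emeasure (count_space UNIV) (exp_regular_zeros A l (dominance_cell A l s) (d \<omega>)))"
      by (intro emeasure_count_space_UN_le finite_strict_selections fin)
    finally show ?thesis .
  qed
  have Nm: "(\<lambda>c. emeasure (count_space UNIV) (exp_regular_zeros A l (dominance_cell A l s) c)) \<in> borel_measurable ?P" for s
    by (rule measurable_exp_regular_zeros_count[OF closed_dominance_cell])
  have t: "real (t k) - 1 \<ge> 0" for k
  proof -
    have "card (A k) > 0" using fin ne by (simp add: card_gt_0_iff)
    then show ?thesis using assms(4)[of k] by simp
  qed
  define b where "b = 1 / 4 ^ CARD('n) * (\<Prod>k\<in>UNIV. real (t k) - 1)"
  have b: "b \<ge> 0" unfolding b_def using t by (simp add: prod_nonneg)
  have "(\<integral>\<^sup>+\<omega>. emeasure (count_space UNIV)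
            (regular_zeros (fewnomial_system A (\<lambda>k \<alpha>. F k \<alpha> \<omega>)) pos_orthant) \<partial>M)
      \<le> (\<integral>\<^sup>+\<omega>. (\<Sum>s\<in>?S. emeasure (count_space UNIV) (exp_regular_zeros A l (dominance_cell A l s) (d \<omega>))) \<partial>M)"
    by (intro nn_integral_mono count_le)
  also have "\<dots> = (\<Sum>s\<in>?S. \<integral>\<^sup>+\<omega>. emeasure (count_space UNIV) (exp_regular_zeros A l (dominance_cell A l s) (d \<omega>)) \<partial>M)"
    by (rule nn_integral_sum) (rule measurable_compose[OF dm Nm])
  also have "\<dots> = (\<Sum>s\<in>?S. \<integral>\<^sup>+c. emeasure (count_space UNIV) (exp_regular_zeros A l (dominance_cell A l s) c) \<partial>?P)"
  proof (rule sum.cong[OF refl])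
    fix s
    show "(\<integral>\<^sup>+\<omega>. emeasure (count_space UNIV) (exp_regular_zeros A l (dominance_cell A l s) (d \<omega>)) \<partial>M)
        = (\<integral>\<^sup>+c. emeasure (count_space UNIV) (exp_regular_zeros A l (dominance_cell A l s) c) \<partial>?P)"
      using nn_integral_distr[OF dm, of "\<lambda>c. emeasure (count_space UNIV) (exp_regular_zeros A l (dominance_cell A l s) c)"] Nm
      by (simp add: law)
  qed
  also have "\<dots> \<le> (\<Sum>s\<in>?S. ennreal b)"
  proof (rule sum_mono)
    fix s assume "s \<in> ?S"
    then have "s k \<in> A k" for k using strict_selections_subset by blast
    from expected_zeros_in_cell_le[of A s l, OF fin this]
    show "(\<integral>\<^sup>+c. emeasure (count_space UNIV) (exp_regular_zeros A l (dominance_cell A l s) c) \<partial>?P) \<le> ennreal b"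
      by (simp add: b_def assms(4))
  qed
  also have "\<dots> = ennreal (real (card ?S) * b)"
    using b by (simp add: ennreal_of_nat_eq_real_of_nat ennreal_mult)
  also have "\<dots> \<le> ennreal (real (num_vertices (\<Sum>k\<in>UNIV. upper_envelope (A k) (l k))) * b)"
    using card_strict_selections_le[of A l, OF fin] b by (intro ennreal_leI mult_right_mono) simp_all
  finally show ?thesis unfolding b_def by (simp add: mult_ac)
qed

end
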